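(* Let $\Omega(\mathbb{R}^m)$ be the space of Borel probability measures on $\mathbb{R}^m$ with the metric $d_L$. The sets $\Omega_0(\mathbb{R}^m)=\{\mu\in\Omega(\mathbb{R}^m):\lim_{r\to0^+}D_r(\mu)=D_0(\mu)=\dim_H(\mu)\}$ and $\Omega_{0>}(\mathbb{R}^m)=\{\mu\in\Omega(\mathbb{R}^m):\lim_{r\to0^+}D_r(\mu)=D_0(\mu)>\dim_H(\mu)\}$ are both dense in $(\Omega(\mathbb{R}^m),d_L)$.
   Context: $d_L(\mu,\nu)=\sup\{|\int h\,d\mu-\int h\,d\nu|: h:\mathbb{R}^m\to\mathbb{R}\text{ Lipschitz with constant}\le1\}$. For $r>0$, $V_{n,r}(\mu)=\inf\{\int d(x,A)^r\,d\mu(x):\mathrm{Card}(A)\le n\}$ and $D_r(\mu)=\lim_n\frac{r\log n}{-\log V_{n,r}(\mu)}$; $e_n(\mu)=\exp\inf\{\int\log d(x,A)\,d\mu(x):\mathrm{Card}(A)\le n\}$ and $D_0(\mu)=\lim_n\frac{\log n}{-\log e_n(\mu)}$; throughout it is assumed these quantization dimensions exist whenever they occur. $\dim_H(\mu)=\inf\{\dim_H E: E\text{ Borel},\ \mu(E)=1\}$ is the Hausdorff dimension of $\mu$.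
   Formalization: The space of Borel probability measures is restricted to those with finite first moment, since d_L over all 1-Lipschitz h is infinite or undefined for heavier tails (e.g. Cauchy, h(x)=|x|) and so is not a metric there. *)

theory Defs
  imports "HOL-Probability.Probability"
begin

text \<open>Borel probability measures on R^m (R^m is modelled by an arbitrary
  euclidean_space type) for which d_L is a genuine (finite) metric, i.e. with
  finite first moment.\<close>
definition Omega :: "('a::euclidean_space) measure set" where
  "Omega = {\<mu>. sets \<mu> = sets borel \<and> prob_space \<mu> \<and> integrable \<mu> (\<lambda>x. norm x)}"

definition dL :: "('a::euclidean_space) measure \<Rightarrow> 'a measure \<Rightarrow> real" where
  "dL \<mu> \<nu> = (SUP h\<in>{h::'a \<Rightarrow> real. 1-lipschitz_on UNIV h}.
               \<bar>integral\<^sup>L \<mu> h - integral\<^sup>L \<nu> h\<bar>)"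

definition Vq :: "nat \<Rightarrow> real \<Rightarrow> ('a::euclidean_space) measure \<Rightarrow> ennreal" where
  "Vq n r \<mu> = (INF A\<in>{A::'a set. finite A \<and> A \<noteq> {} \<and> card A \<le> n}.
                \<integral>\<^sup>+ x. ennreal (infdist x A powr r) \<partial>\<mu>)"

text \<open>The terms r log n / (- log V_{n,r}), with the convention -log 0 = +infinity.\<close>
definition Dr_term :: "real \<Rightarrow> ('a::euclidean_space) measure \<Rightarrow> nat \<Rightarrow> real" where
  "Dr_term r \<mu> n = (if Vq n r \<mu> = 0 then 0
                     else r * ln (real n) / (- ln (enn2real (Vq n r \<mu>))))"

definition has_Dr :: "real \<Rightarrow> ('a::euclidean_space) measure \<Rightarrow> real \<Rightarrow> bool" where
  "has_Dr r \<mu> d \<longleftrightarrow> (\<forall>\<^sub>F n in sequentially. Vq n r \<mu> < \<infinity>) \<and> (Dr_term r \<mu> \<longlonglongrightarrow> d)"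

definition Dr :: "real \<Rightarrow> ('a::euclidean_space) measure \<Rightarrow> real" where
  "Dr r \<mu> = (THE d. has_Dr r \<mu> d)"

text \<open>The integral of log d(x,A), as an extended real
  (positive part minus negative part; log 0 = -infinity).\<close>
definition log_int :: "('a::euclidean_space) measure \<Rightarrow> 'a set \<Rightarrow> ereal" where
  "log_int \<mu> A =
     ereal (enn2real (\<integral>\<^sup>+ x. ennreal (max 0 (ln (infdist x A))) \<partial>\<mu>))
     - enn2ereal (\<integral>\<^sup>+ x. (if infdist x A = 0 then \<infinity> else ennreal (max 0 (- ln (infdist x A)))) \<partial>\<mu>)"

definition log_en :: "nat \<Rightarrow> ('a::euclidean_space) measure \<Rightarrow> ereal" where
  "log_en n \<mu> = (INF A\<in>{A::'a set. finite A \<and> A \<noteq> {} \<and> card A \<le> n}. log_int \<mu> A)"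

text \<open>The terms log n / (- log e_n), with the convention -log 0 = +infinity.\<close>
definition D0_term :: "('a::euclidean_space) measure \<Rightarrow> nat \<Rightarrow> real" where
  "D0_term \<mu> n = (if log_en n \<mu> = - \<infinity> then 0
                   else ln (real n) / (- real_of_ereal (log_en n \<mu>)))"

definition has_D0 :: "('a::euclidean_space) measure \<Rightarrow> real \<Rightarrow> bool" where
  "has_D0 \<mu> d \<longleftrightarrow> (\<forall>\<^sub>F n in sequentially. \<bar>log_en n \<mu>\<bar> \<noteq> \<infinity> \<or> log_en n \<mu> = - \<infinity>)
                   \<and> (D0_term \<mu> \<longlonglongrightarrow> d)"

definition D0 :: "('a::euclidean_space) measure \<Rightarrow> real" where
  "D0 \<mu> = (THE d. has_D0 \<mu> d)"

definition hausdorff_pre :: "real \<Rightarrow> real \<Rightarrow> ('a::euclidean_space) set \<Rightarrow> ennreal" where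
  "hausdorff_pre s \<delta> E = (INF U\<in>{U::nat \<Rightarrow> 'a set. E \<subseteq> (\<Union>i. U i) \<and>
                                   (\<forall>i. bounded (U i) \<and> diameter (U i) \<le> \<delta>)}.
                            (\<Sum>i. ennreal (diameter (U i) powr s)))"

definition hausdorff_measure :: "real \<Rightarrow> ('a::euclidean_space) set \<Rightarrow> ennreal" where
  "hausdorff_measure s E = (SUP \<delta>\<in>{0<..}. hausdorff_pre s \<delta> E)"

definition hausdorff_dim :: "('a::euclidean_space) set \<Rightarrow> real" where
  "hausdorff_dim E = Inf {s. 0 \<le> s \<and> hausdorff_measure s E = 0}"

definition hausdorff_dim_measure :: "('a::euclidean_space) measure \<Rightarrow> real" where
  "hausdorff_dim_measure \<mu> = Inf {hausdorff_dim E | E. E \<in> sets borel \<and> emeasure \<mu> E = 1}"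

definition Omega0 :: "('a::euclidean_space) measure set" where
  "Omega0 = {\<mu>\<in>Omega. (\<forall>\<^sub>F r in at_right 0. \<exists>d. has_Dr r \<mu> d) \<and> (\<exists>d. has_D0 \<mu> d) \<and>
                       ((\<lambda>r. Dr r \<mu>) \<longlongrightarrow> D0 \<mu>) (at_right 0) \<and>
                       D0 \<mu> = hausdorff_dim_measure \<mu>}"

definition Omega0_gt :: "('a::euclidean_space) measure set" where
  "Omega0_gt = {\<mu>\<in>Omega. (\<forall>\<^sub>F r in at_right 0. \<exists>d. has_Dr r \<mu> d) \<and> (\<exists>d. has_D0 \<mu> d) \<and>
                       ((\<lambda>r. Dr r \<mu>) \<longlongrightarrow> D0 \<mu>) (at_right 0) \<and>
                       D0 \<mu> > hausdorff_dim_measure \<mu>}"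

definition dense_dL :: "('a::euclidean_space) measure set \<Rightarrow> bool" where
  "dense_dL S \<longleftrightarrow> (\<forall>\<mu>\<in>Omega. \<forall>\<epsilon>>0. \<exists>\<nu>\<in>S. dL \<mu> \<nu> < \<epsilon>)"

end

theory Submission
  imports Defs
begin

text \<open>
  A measure with finite support has \<open>V\<^bsub>n,r\<^esub> = e\<^sub>n = 0\<close> for large \<open>n\<close>, so all its dimensions vanish, and
  such measures are dense: push \<open>\<mu>\<close> forward along a simple function close to the identity.

  For the strict inequality, blur such a measure by a small multiple of a random variable
  \<open>Y \<in> [0, 1]\<close> along a fixed direction. The binary digits of \<open>Y\<close> are fair coins, except that the blocks
  \<open>[4\<^sup>c, 2 \<cdot> 4\<^sup>c)\<close> with \<open>c\<close> in a random infinite set are replaced by zeros, where the probability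
  that a given \<open>c\<close> is chosen tends to \<open>0\<close>. Since zero blocks occur infinitely often, the law of \<open>Y\<close>
  lives on a limsup set of dimension at most \<open>3/4\<close>. At any fixed scale, however, all but a vanishing
  proportion of the mass looks uniform, and even the exceptional part has at least a third of its
  digits free; hence \<open>- log e\<^sub>n \<le> (1 + o(1)) log n\<close>. As \<open>n\<close> points are \<open>C/n\<close>-dense in finitely many
  segments, \<open>D\<^sub>0 = D\<^sub>r = 1\<close> for all \<open>r > 0\<close>.
\<close>

subsection \<open>Hausdorff measure and dimension\<close>

text \<open>Zero blocks at fixed positions would not do: if the block \<open>[4^c, 2 * 4^c)\<close>
  were zero almost surely for infinitely many c, then n = 2^(4^c) intervals of length n^-2 would
  carry all the mass, and \<open>log n / (- log e_n)\<close> would be at most 1/2 for these n. Hence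
  the randomisation: every sample has infinitely many zero blocks, yet each block concerns only a
  small share of the samples. The second obstacle is that \<open>- log d(x, A)\<close> is unbounded,
  so a part of small mass cannot simply be discarded. Written as a sum over dyadic scales, its
  integral is governed by the mass within 2^-i of A. With j = log2 n, the scales up to about j give
  the main term; from there to 3j the exceptional part enters only with its small mass; past 3j the
  third of free digits makes the masses summable. The covering sums of the limsup set converge for
  every exponent above 1/2; 3/4 is a convenient value between that and 1.\<close>

lemma hausdorff_measure_eq_0I:
  fixes E :: "'a::euclidean_space set"
  assumes "\<And>\<delta> \<eta>. \<delta> > 0 \<Longrightarrow> \<eta> > 0 \<Longrightarrow>
    \<exists>V :: nat \<Rightarrow> nat \<Rightarrow> 'a set. E \<subseteq> (\<Union>k q. V k q) \<and> (\<forall>k q. bounded (V k q) \<and> diameter (V k q) \<le> \<delta>)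
      \<and> (\<Sum>k. \<Sum>q. ennreal (diameter (V k q) powr s)) \<le> ennreal \<eta>"
  shows "hausdorff_measure s E = 0"
proof -
  have "hausdorff_pre s \<delta> E \<le> 0" if "\<delta> > 0" for \<delta>
  proof (rule ennreal_le_epsilon)
    fix \<eta> :: real assume "\<eta> > 0"
    then obtain V :: "nat \<Rightarrow> nat \<Rightarrow> 'a set" where V: "E \<subseteq> (\<Union>k q. V k q)"
      "\<And>k q. bounded (V k q) \<and> diameter (V k q) \<le> \<delta>"
      "(\<Sum>k. \<Sum>q. ennreal (diameter (V k q) powr s)) \<le> ennreal \<eta>"
      using assms[OF \<open>\<delta> > 0\<close>] by meson
    \<comment> \<open>Unions and limsup sets deliver one family of cover sets for each k, hence the
      double index; \<open>prod_decode\<close> flattens it into the single sequence that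
      \<open>hausdorff_pre\<close> demands.\<close>
    define U where "U = (\<lambda>i. case prod_decode i of (k, q) \<Rightarrow> V k q)"
    have "V k q \<subseteq> (\<Union>i. U i)" for k q
    proof -
      have "V k q = U (prod_encode (k, q))" by (simp add: U_def)
      then show ?thesis by blast
    qed
    then have "E \<subseteq> (\<Union>i. U i)" by (intro order_trans[OF V(1)] UN_least)
    moreover have "\<forall>i. bounded (U i) \<and> diameter (U i) \<le> \<delta>"
      using V(2) by (simp add: U_def split: prod.split)
    ultimately have "hausdorff_pre s \<delta> E \<le> (\<Sum>i. ennreal (diameter (U i) powr s))"
      unfolding hausdorff_pre_def by (intro INF_lower) auto
    also have "\<dots> = (\<Sum>i. (\<lambda>(k, q). ennreal (diameter (V k q) powr s)) (prod_decode i))"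
      by (simp add: U_def case_prod_unfold)
    also have "\<dots> = (\<Sum>k. \<Sum>q. ennreal (diameter (V k q) powr s))"
      by (rule suminf_ennreal_2dimen) simp
    finally show "hausdorff_pre s \<delta> E \<le> 0 + ennreal \<eta>" using V(3) by simp
  qed
  then have "hausdorff_measure s E \<le> 0"
    unfolding hausdorff_measure_def by (intro SUP_least) auto
  then show ?thesis by simp
qed

lemma hausdorff_measure_eq_0D:
  fixes E :: "'a::euclidean_space set"
  assumes "hausdorff_measure s E = 0" "\<delta> > 0" "\<eta> > 0"
  obtains U :: "nat \<Rightarrow> 'a set" where "E \<subseteq> (\<Union>i. U i)" "\<And>i. bounded (U i)" "\<And>i. diameter (U i) \<le> \<delta>"
    "(\<Sum>i. ennreal (diameter (U i) powr s)) \<le> ennreal \<eta>"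
proof -
  have "hausdorff_pre s \<delta> E \<le> hausdorff_measure s E"
    unfolding hausdorff_measure_def by (intro SUP_upper) (use assms in auto)
  then have "hausdorff_pre s \<delta> E < ennreal \<eta>" using assms by simp
  then obtain U :: "nat \<Rightarrow> 'a set" where "E \<subseteq> (\<Union>i. U i) \<and> (\<forall>i. bounded (U i) \<and> diameter (U i) \<le> \<delta>)"
     "(\<Sum>i. ennreal (diameter (U i) powr s)) < ennreal \<eta>"
    unfolding hausdorff_pre_def INF_less_iff by auto
  then show ?thesis by (intro that[of U]) (simp_all add: less_imp_le)
qed

lemma hausdorff_measure_UN_null:
  fixes E :: "nat \<Rightarrow> 'a::euclidean_space set"
  assumes "\<And>i. hausdorff_measure s (E i) = 0"
  shows "hausdorff_measure s (\<Union>i. E i) = 0"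
proof (rule hausdorff_measure_eq_0I)
  fix \<delta> \<eta> :: real assume pos: "\<delta> > 0" "\<eta> > 0"
  have "\<exists>U :: nat \<Rightarrow> 'a set. E k \<subseteq> (\<Union>i. U i) \<and> (\<forall>i. bounded (U i) \<and> diameter (U i) \<le> \<delta>)
     \<and> (\<Sum>i. ennreal (diameter (U i) powr s)) \<le> ennreal (\<eta> * (1/2) ^ Suc k)" for k
    by (rule hausdorff_measure_eq_0D[OF assms[of k] pos(1), of "\<eta> * (1/2) ^ Suc k"])
       (use pos in auto)
  then obtain V :: "nat \<Rightarrow> nat \<Rightarrow> 'a set" where V: "\<And>k. E k \<subseteq> (\<Union>i. V k i)"
     "\<And>k i. bounded (V k i) \<and> diameter (V k i) \<le> \<delta>"
     "\<And>k. (\<Sum>i. ennreal (diameter (V k i) powr s)) \<le> ennreal (\<eta> * (1/2) ^ Suc k)"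
    by metis
  have "(\<Sum>k. \<Sum>i. ennreal (diameter (V k i) powr s)) \<le> (\<Sum>k. ennreal (\<eta> * (1/2) ^ Suc k))"
    by (intro suminf_le V(3)) auto
  also have "\<dots> = ennreal \<eta>"
    using sums_mult[OF power_half_series, of \<eta>] pos
    by (intro suminf_ennreal_eq) auto
  finally show "\<exists>V :: nat \<Rightarrow> nat \<Rightarrow> 'a set. (\<Union>i. E i) \<subseteq> (\<Union>k q. V k q) \<and>
      (\<forall>k q. bounded (V k q) \<and> diameter (V k q) \<le> \<delta>) \<and>
      (\<Sum>k. \<Sum>q. ennreal (diameter (V k q) powr s)) \<le> ennreal \<eta>"
    using V(2) by (intro exI[of _ V] conjI UN_mono V(1)) auto
qed

lemma diameter_lipschitz_image_le:
  fixes g :: "'a::euclidean_space \<Rightarrow> 'b::euclidean_space"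
  assumes g: "L-lipschitz_on UNIV g" and U: "bounded U"
  shows "bounded (g ` U)" "diameter (g ` U) \<le> L * diameter U"
proof -
  have L: "L \<ge> 0" by (rule lipschitz_on_nonneg[OF g])
  have *: "dist (g x) (g y) \<le> L * diameter U" if "x \<in> U" "y \<in> U" for x y
  proof -
    have "dist (g x) (g y) \<le> L * dist x y" by (rule lipschitz_onD[OF g]) auto
    also have "\<dots> \<le> L * diameter U"
      by (intro mult_left_mono diameter_bounded_bound U that L)
    finally show ?thesis .
  qed
  show "bounded (g ` U)"
  proof (cases "U = {}")
    case False
    then obtain x where "x \<in> U" by auto
    then show ?thesis unfolding bounded_def using * by blast
  qed simp
  show "diameter (g ` U) \<le> L * diameter U"
    by (rule diameter_le) (use * L diameter_ge_0[OF U] in \<open>auto simp: dist_norm\<close>)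
qed

lemma hausdorff_measure_lipschitz_image_null:
  fixes g :: "'a::euclidean_space \<Rightarrow> 'b::euclidean_space"
  assumes E: "hausdorff_measure s E = 0" and g: "L-lipschitz_on UNIV g" and L: "L > 0" and s: "s \<ge> 0"
  shows "hausdorff_measure s (g ` E) = 0"
proof (rule hausdorff_measure_eq_0I)
  fix \<delta> \<eta> :: real assume pos: "\<delta> > 0" "\<eta> > 0"
  obtain U :: "nat \<Rightarrow> 'a set" where U: "E \<subseteq> (\<Union>i. U i)" "\<And>i. bounded (U i)" "\<And>i. diameter (U i) \<le> \<delta> / L"
    "(\<Sum>i. ennreal (diameter (U i) powr s)) \<le> ennreal (\<eta> / L powr s)"
    by (rule hausdorff_measure_eq_0D[OF E, of "\<delta> / L" "\<eta> / L powr s"]) (use pos L in auto)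
  \<comment> \<open>A single cover is stored in the column q = 0. The empty padding costs nothing:
    its diameter is 0, and \<open>0 powr s = 0\<close> for every s, even for s = 0.\<close>
  define V :: "nat \<Rightarrow> nat \<Rightarrow> 'b set" where "V = (\<lambda>k q. if q = 0 then g ` U k else {})"
  have 1: "bounded (V k q)" for k q
    using diameter_lipschitz_image_le(1)[OF g U(2)] by (simp add: V_def)
  have 2: "diameter (V k q) \<le> \<delta>" for k q
  proof -
    have "L * diameter (U k) \<le> \<delta>" using U(3)[of k] L by (simp add: field_simps)
    then show ?thesis
      using diameter_lipschitz_image_le(2)[OF g U(2)[of k]] pos by (simp add: V_def)
  qed
  have "(\<Sum>q. ennreal (diameter (V k q) powr s)) \<le> ennreal (L powr s) * ennreal (diameter (U k) powr s)" for k
  proof -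
    have "(\<Sum>q. ennreal (diameter (V k q) powr s)) = (\<Sum>q\<in>{0}. ennreal (diameter (V k q) powr s))"
      by (rule suminf_finite) (auto simp: V_def)
    also have "\<dots> \<le> ennreal ((L * diameter (U k)) powr s)"
      using diameter_lipschitz_image_le[OF g U(2)[of k]] s
      by (auto simp: V_def intro!: ennreal_leI powr_mono2 diameter_ge_0)
    finally show ?thesis
      using L diameter_ge_0[OF U(2)[of k]] by (simp add: powr_mult ennreal_mult)
  qed
  then have "(\<Sum>k. \<Sum>q. ennreal (diameter (V k q) powr s)) \<le> (\<Sum>k. ennreal (L powr s) * ennreal (diameter (U k) powr s))"
    by (intro suminf_le) auto
  also have "\<dots> = ennreal (L powr s) * (\<Sum>k. ennreal (diameter (U k) powr s))"
    by simp
  also have "\<dots> \<le> ennreal (L powr s) * ennreal (\<eta> / L powr s)"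
    by (intro mult_left_mono U(4)) auto
  also have "\<dots> = ennreal \<eta>" using L pos by (simp flip: ennreal_mult)
  finally have 3: "(\<Sum>k. \<Sum>q. ennreal (diameter (V k q) powr s)) \<le> ennreal \<eta>" .
  have "g ` E \<subseteq> (\<Union>k q. V k q)"
  proof
    fix y assume "y \<in> g ` E"
    then obtain k where "y \<in> g ` U k" using U(1) by blast
    then have "y \<in> V k 0" by (simp add: V_def)
    then show "y \<in> (\<Union>k q. V k q)" by blast
  qed
  with 1 2 3 show "\<exists>V :: nat \<Rightarrow> nat \<Rightarrow> 'b set. g ` E \<subseteq> (\<Union>k q. V k q) \<and>
      (\<forall>k q. bounded (V k q) \<and> diameter (V k q) \<le> \<delta>) \<and>
      (\<Sum>k. \<Sum>q. ennreal (diameter (V k q) powr s)) \<le> ennreal \<eta>"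
    by blast
qed

text \<open>Lets grid cells and singletons serve as covers under their natural index sets; an
  enumeration padded by empty sets gives the sequence.\<close>

lemma hausdorff_measure_finite_cover:
  fixes E :: "'a::euclidean_space set"
  assumes "\<And>\<delta> \<eta>. \<delta> > 0 \<Longrightarrow> \<eta> > 0 \<Longrightarrow>
    \<exists>(I :: 'i set) V. finite I \<and> E \<subseteq> (\<Union>i\<in>I. V i) \<and> (\<forall>i\<in>I. bounded (V i) \<and> diameter (V i) \<le> \<delta>)
      \<and> (\<Sum>i\<in>I. diameter (V i) powr s) \<le> \<eta>"
  shows "hausdorff_measure s E = 0"
proof (rule hausdorff_measure_eq_0I)
  fix \<delta> \<eta> :: real assume pos: "\<delta> > 0" "\<eta> > 0"
  obtain I :: "'i set" and V where V: "finite I" "E \<subseteq> (\<Union>i\<in>I. V i)"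
     "\<forall>i\<in>I. bounded (V i) \<and> diameter (V i) \<le> \<delta>" "(\<Sum>i\<in>I. diameter (V i) powr s) \<le> \<eta>"
    using assms[OF pos] by blast
  obtain f where f: "bij_betw f {..<card I} I"
    using ex_bij_betw_nat_finite[OF V(1)] by (auto simp: atLeast0LessThan)
  define W :: "nat \<Rightarrow> nat \<Rightarrow> 'a set" where "W = (\<lambda>k q. if k = 0 \<and> q < card I then V (f q) else {})"
  have W0: "(\<Sum>q. ennreal (diameter (W k q) powr s)) = (if k = 0 then \<Sum>i\<in>I. ennreal (diameter (V i) powr s) else 0)" for k
  proof -
    have "(\<Sum>q. ennreal (diameter (W k q) powr s)) = (\<Sum>q<card I. ennreal (diameter (W k q) powr s))"
      by (rule suminf_finite) (auto simp: W_def)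
    also have "\<dots> = (if k = 0 then \<Sum>q<card I. ennreal (diameter (V (f q)) powr s) else 0)"
      by (simp add: W_def)
    finally show ?thesis by (simp add: sum.reindex_bij_betw[OF f, of "\<lambda>i. ennreal (diameter (V i) powr s)"])
  qed
  have "(\<Sum>k. \<Sum>q. ennreal (diameter (W k q) powr s)) = (\<Sum>k\<in>{0}. \<Sum>q. ennreal (diameter (W k q) powr s))"
    by (rule suminf_finite) (auto simp: W0)
  also have "\<dots> = ennreal (\<Sum>i\<in>I. diameter (V i) powr s)" by (simp add: W0 sum_ennreal)
  finally have "(\<Sum>k. \<Sum>q. ennreal (diameter (W k q) powr s)) \<le> ennreal \<eta>"
    using V(4) by (simp add: ennreal_leI)
  moreover have "E \<subseteq> (\<Union>k q. W k q)"
  proof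
    fix x assume "x \<in> E"
    then obtain i where "i \<in> I" "x \<in> V i" using V(2) by auto
    then obtain q where "q < card I" "x \<in> V (f q)" using f by (metis bij_betw_iff_bijections lessThan_iff)
    then have "x \<in> W 0 q" by (simp add: W_def)
    then show "x \<in> (\<Union>k q. W k q)" by blast
  qed
  moreover have "\<forall>k q. bounded (W k q) \<and> diameter (W k q) \<le> \<delta>"
    using V(3) pos bij_betwE[OF f] by (auto simp: W_def)
  ultimately show "\<exists>V :: nat \<Rightarrow> nat \<Rightarrow> 'a set. E \<subseteq> (\<Union>k q. V k q) \<and>
      (\<forall>k q. bounded (V k q) \<and> diameter (V k q) \<le> \<delta>) \<and>
      (\<Sum>k. \<Sum>q. ennreal (diameter (V k q) powr s)) \<le> ennreal \<eta>"
    by blast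
qed

text \<open>With m = \<open>DIM('a)\<close>, the cube splits into \<open>(2 * N * k) ^ m\<close>
  cells of diameter at most m/k; for the exponent m + 1 the covering sum is of order 1/k.\<close>

lemma hausdorff_measure_box_null:
  fixes N :: nat
  shows "hausdorff_measure (real (Suc DIM('a))) {x::'a::euclidean_space. \<forall>i\<in>Basis. \<bar>x \<bullet> i\<bar> < N} = 0"
    (is "hausdorff_measure ?s ?E = 0")
proof (rule hausdorff_measure_finite_cover)
  fix \<delta> \<eta> :: real assume pos: "\<delta> > 0" "\<eta> > 0"
  define m where "m = DIM('a)"
  have m: "m > 0" by (simp add: m_def)
  \<comment> \<open>The first bound keeps the cell diameters within \<delta>, the second the
    covering sum within \<eta>.\<close>
  obtain k :: nat where k: "real k > max (m / \<delta>) ((2 * real N) ^ m * real m ^ Suc m / \<eta>)"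
    using reals_Archimedean2 by blast
  have k0: "real k > 0"
  proof -
    have "0 \<le> m / \<delta>" using pos by simp
    also have "\<dots> < k" using k by simp
    finally show ?thesis .
  qed
  define I :: "('a \<Rightarrow> int) set" where "I = PiE Basis (\<lambda>_. {- int (N * k)..<int (N * k)})"
  define V :: "('a \<Rightarrow> int) \<Rightarrow> 'a set" where
    "V = (\<lambda>g. {x. \<forall>i\<in>Basis. of_int (g i) / k \<le> x \<bullet> i \<and> x \<bullet> i \<le> (of_int (g i) + 1) / k})"
  have fin: "finite I" unfolding I_def by (intro finite_PiE) auto
  have cI: "real (card I) = (2 * real N * real k) ^ m"
    by (simp add: I_def card_PiE m_def nat_add_distrib nat_mult_distrib power_mult_distrib)
  have dist: "dist x y \<le> m / k" if "x \<in> V g" "y \<in> V g" for x y g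
  proof -
    have "\<bar>(x - y) \<bullet> i\<bar> \<le> 1 / k" if i: "i \<in> Basis" for i
    proof -
      have "of_int (g i) / k \<le> x \<bullet> i" "x \<bullet> i \<le> of_int (g i) / k + 1 / k"
        "of_int (g i) / k \<le> y \<bullet> i" "y \<bullet> i \<le> of_int (g i) / k + 1 / k"
        using \<open>x \<in> V g\<close> \<open>y \<in> V g\<close> i by (auto simp: V_def add_divide_distrib)
      then show ?thesis by (simp add: inner_diff_left abs_le_iff)
    qed
    then have "(\<Sum>i\<in>Basis. \<bar>(x - y) \<bullet> i\<bar>) \<le> (\<Sum>i\<in>(Basis::'a set). 1 / k)" by (intro sum_mono) auto
    then show ?thesis using norm_le_l1[of "x - y"] by (simp add: dist_norm m_def)
  qed
  have diam: "diameter (V g) \<le> m / k" for g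
    by (rule diameter_le) (use dist[of _ g] k0 in \<open>auto simp: dist_norm\<close>)
  have bdd: "bounded (V g)" for g
  proof (cases "V g = {}")
    case False
    then obtain x where "x \<in> V g" by auto
    then show ?thesis unfolding bounded_def using dist by blast
  qed simp
  have cov: "?E \<subseteq> (\<Union>g\<in>I. V g)"
  proof
    fix x assume x: "x \<in> ?E"
    define g where "g = restrict (\<lambda>i. \<lfloor>real k * (x \<bullet> i)\<rfloor>) Basis"
    have "g \<in> I"
    proof -
      have "\<lfloor>real k * (x \<bullet> i)\<rfloor> \<in> {- int (N * k)..<int (N * k)}" if "i \<in> Basis" for i
      proof -
        have "\<bar>x \<bullet> i\<bar> < N" using x that by auto
        then have "real k * \<bar>x \<bullet> i\<bar> < real k * real N" using k0 by (intro mult_strict_left_mono) auto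
        then have "\<bar>real k * (x \<bullet> i)\<bar> < real N * real k" by (simp add: abs_mult mult.commute)
        then have "- (real N * real k) \<le> real k * (x \<bullet> i)" "real k * (x \<bullet> i) < real N * real k"
          by linarith+
        then show ?thesis by (simp add: le_floor_iff floor_less_iff)
      qed
      then show ?thesis by (auto simp: I_def g_def)
    qed
    moreover have "x \<in> V g"
    proof -
      have "of_int \<lfloor>real k * (x \<bullet> i)\<rfloor> \<le> real k * (x \<bullet> i)" "real k * (x \<bullet> i) \<le> of_int \<lfloor>real k * (x \<bullet> i)\<rfloor> + 1" for i
        by linarith+
      then show ?thesis using k0 by (auto simp: V_def g_def field_simps)
    qed
    ultimately show "x \<in> (\<Union>g\<in>I. V g)" by blast
  qed
  have "(\<Sum>g\<in>I. diameter (V g) powr ?s) \<le> (\<Sum>g\<in>I. (m / k) powr ?s)"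
    by (intro sum_mono powr_mono2 diam diameter_ge_0 bdd) auto
  also have "\<dots> = (2 * real N * real k) ^ m * (m / k) ^ Suc m"
    using k0 m by (subst powr_realpow) (auto simp: cI m_def)
  also have "\<dots> = (2 * real N) ^ m * real m ^ Suc m / k"
    using k0 by (simp add: field_simps power_mult_distrib power_divide)
  also have "\<dots> \<le> \<eta>" using k k0 pos by (simp add: field_simps)
  finally have sum: "(\<Sum>g\<in>I. diameter (V g) powr ?s) \<le> \<eta>" .
  have "m / k \<le> \<delta>" using k k0 pos by (simp add: field_simps)
  then have "\<forall>g\<in>I. bounded (V g) \<and> diameter (V g) \<le> \<delta>" using diam bdd by (meson order_trans)
  with fin cov sum show "\<exists>(I :: ('a \<Rightarrow> int) set) V. finite I \<and> ?E \<subseteq> (\<Union>i\<in>I. V i) \<and>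
      (\<forall>i\<in>I. bounded (V i) \<and> diameter (V i) \<le> \<delta>) \<and> (\<Sum>i\<in>I. diameter (V i) powr ?s) \<le> \<eta>"
    by blast
qed

lemma hausdorff_measure_mono: "E \<subseteq> F \<Longrightarrow> hausdorff_measure s E \<le> hausdorff_measure s F"
  unfolding hausdorff_measure_def hausdorff_pre_def
  by (intro SUP_mono' INF_superset_mono) auto

text \<open>Supplies a member of the set whose infimum defines \<open>hausdorff_dim\<close>; the
  real-valued \<open>Inf\<close> of an empty set would carry no information.\<close>

lemma hausdorff_measure_Suc_DIM:
  "hausdorff_measure (real (Suc DIM('a))) (E :: 'a::euclidean_space set) = 0"
proof -
  have "(UNIV :: 'a set) \<subseteq> (\<Union>N::nat. {x. \<forall>i\<in>Basis. \<bar>x \<bullet> i\<bar> < N})"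
  proof
    fix x :: 'a
    obtain N :: nat where "norm x < N" using reals_Archimedean2 by blast
    then have "\<forall>i\<in>Basis. \<bar>x \<bullet> i\<bar> < N" using Basis_le_norm le_less_trans by blast
    then show "x \<in> (\<Union>N::nat. {x. \<forall>i\<in>Basis. \<bar>x \<bullet> i\<bar> < N})" by blast
  qed
  then have "E \<subseteq> (\<Union>N::nat. {x. \<forall>i\<in>Basis. \<bar>x \<bullet> i\<bar> < N})" by blast
  from hausdorff_measure_mono[OF this, of "real (Suc DIM('a))"]
  show ?thesis by (subst (asm) hausdorff_measure_UN_null[OF hausdorff_measure_box_null]) simp
qed

lemma hausdorff_dim_nonneg: "hausdorff_dim E \<ge> 0"
proof -
  have "real (Suc DIM('a)) \<in> {s. 0 \<le> s \<and> hausdorff_measure s E = 0}" for E :: "'a set"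
    using hausdorff_measure_Suc_DIM[of E] by simp
  then show ?thesis unfolding hausdorff_dim_def by (intro cInf_greatest) blast+
qed

lemma hausdorff_dim_le: "s \<ge> 0 \<Longrightarrow> hausdorff_measure s E = 0 \<Longrightarrow> hausdorff_dim E \<le> s"
  unfolding hausdorff_dim_def by (intro cInf_lower bdd_belowI[of _ 0]) auto

lemma hausdorff_dim_measure_le:
  assumes "E \<in> sets borel" "emeasure \<mu> E = 1" "s \<ge> 0" "hausdorff_measure s E = 0"
  shows "hausdorff_dim_measure \<mu> \<le> s"
proof -
  have "hausdorff_dim_measure \<mu> \<le> hausdorff_dim E"
    unfolding hausdorff_dim_measure_def
    by (intro cInf_lower bdd_belowI[of _ 0]) (use assms hausdorff_dim_nonneg in auto)
  then show ?thesis using hausdorff_dim_le[OF assms(3,4)] by simp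
qed

lemma hausdorff_dim_measure_nonneg:
  assumes "emeasure \<mu> UNIV = 1"
  shows "hausdorff_dim_measure \<mu> \<ge> 0"
  unfolding hausdorff_dim_measure_def
proof (rule cInf_greatest)
  have "UNIV \<in> sets borel \<and> emeasure \<mu> UNIV = 1" using assms by simp
  then show "{hausdorff_dim E |E. E \<in> sets borel \<and> emeasure \<mu> E = 1} \<noteq> {}" by blast
qed (use hausdorff_dim_nonneg in auto)

text \<open>Singletons have diameter 0, and \<open>0 powr s = 0\<close> also for s = 0. With this
  convention finite sets are null in every dimension, so that s = 0 itself can bound the Hausdorff
  dimension.\<close>

lemma hausdorff_measure_finite_null: "finite F \<Longrightarrow> hausdorff_measure s F = 0"
  by (rule hausdorff_measure_finite_cover) (rule exI[of _ F], rule exI[of _ "\<lambda>x. {x}"], auto)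

subsection \<open>Quantization dimension one\<close>

text \<open>The integrand of the negative part in \<open>log_int\<close>; with values in
  \<open>ennreal\<close> it can be estimated without integrability conditions.\<close>

definition neglog :: "real \<Rightarrow> ennreal" where
  "neglog d = (if d = 0 then \<infinity> else ennreal (max 0 (- ln d)))"

lemma neglog_measurable [measurable]: "neglog \<in> borel_measurable borel"
  unfolding neglog_def by measurable

lemma neglog_ge:
  assumes "0 \<le> d" "d \<le> c" "0 < c" shows "ennreal (- ln c) \<le> neglog d"
proof (cases "d = 0")
  case False
  then have "- ln c \<le> - ln d" using assms by simp
  then show ?thesis using False by (auto simp: neglog_def intro!: ennreal_leI)
qed (simp add: neglog_def)

lemma neglog_antimono:
  assumes "0 \<le> d" "d \<le> c" shows "neglog c \<le> neglog d"
proof (cases "d = 0")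
  case False
  then have "- ln c \<le> - ln d" using assms by simp
  then show ?thesis using False assms by (auto simp: neglog_def intro!: ennreal_leI)
qed (simp add: neglog_def)

text \<open>Shrinking the picture by a factor c costs an additive constant, which is lost against
  \<open>ln n\<close>.\<close>

lemma neglog_mult_le:
  assumes "0 < c" "c \<le> 1" "0 \<le> d"
  shows "neglog (c * d) \<le> ennreal (- ln c) + neglog d"
proof (cases "d = 0")
  case False
  then have d: "d > 0" using assms by simp
  have "ln c \<le> 0" using assms by simp
  then have "max 0 (- ln (c * d)) \<le> - ln c + max 0 (- ln d)"
    using assms d by (simp only: ln_mult max_def split: if_split) linarith
  then have "ennreal (max 0 (- ln (c * d))) \<le> ennreal (- ln c) + ennreal (max 0 (- ln d))"
    using assms by (subst ennreal_plus[symmetric]) (auto intro: ennreal_leI)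
  then show ?thesis using assms d by (simp add: neglog_def)
qed (simp add: neglog_def)

text \<open>The convex function \<open>x \<mapsto> exp (- r x)\<close> lies above its tangent at \<open>L\<close>; integrated, this is
  the case of Jensen's inequality that bounds \<open>V\<^bsub>n,r\<^esub>\<close> from below by \<open>e\<^sub>n\<close>.\<close>

lemma tangent_powr_neglog:
  assumes r: "r > 0" and L: "L \<ge> 0" and d: "d \<ge> 0"
  shows "ennreal (exp (- r * L) * (1 + r * L)) \<le> ennreal (d powr r) + ennreal (exp (- r * L) * r) * neglog d"
proof -
  consider "d = 0" | "0 < d" "d \<le> 1" | "d > 1" using d by linarith
  then show ?thesis
  proof cases
    case 1
    then show ?thesis using r by (simp add: neglog_def ennreal_mult_top)
  next
    case 2
    have "exp (- r * L) * (1 + r * (L + ln d)) \<le> exp (- r * L) * exp (r * (L + ln d))"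
      by (intro mult_left_mono) (auto intro: exp_ge_add_one_self)
    also have "\<dots> = d powr r" using 2 by (simp add: powr_def mult_exp_exp algebra_simps)
    finally have "exp (- r * L) * (1 + r * L) \<le> d powr r + exp (- r * L) * r * (- ln d)"
      by (simp add: algebra_simps)
    then have "ennreal (exp (- r * L) * (1 + r * L)) \<le> ennreal (d powr r + exp (- r * L) * r * (- ln d))"
      by (rule ennreal_leI)
    also have "\<dots> = ennreal (d powr r) + ennreal (exp (- r * L) * r) * ennreal (- ln d)"
      using 2 r by (subst ennreal_plus, simp, simp add: mult_nonneg_nonpos, subst ennreal_mult[symmetric]) auto
    finally show ?thesis using 2 by (simp add: neglog_def)
  next
    \<comment> \<open>Here \<open>neglog d\<close> vanishes and the slope term gives no help; the
      tangent value at 0 is at most 1, and \<open>d powr r\<close> at least 1.\<close>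
    case 3
    have "exp (- r * L) * (1 + r * L) \<le> exp (- r * L) * exp (r * L)"
      by (intro mult_left_mono exp_ge_add_one_self) auto
    also have "\<dots> = 1" by (simp add: mult_exp_exp)
    also have "1 \<le> d powr r" using 3 r by (simp add: ge_one_powr_ge_zero)
    finally have "ennreal (exp (- r * L) * (1 + r * L)) \<le> ennreal (d powr r)" by (rule ennreal_leI)
    then show ?thesis by (rule order_trans) simp
  qed
qed

text \<open>If \<open>neglog\<close> has integral at most L, the slope term of the tangent at L
  takes away at most \<open>exp (- r * L) * (r * L)\<close> from the constant term, which leaves
  \<open>exp (- r * L)\<close>.\<close>

lemma nn_integral_powr_ge_exp_neglog:
  assumes "prob_space M" and [measurable]: "d \<in> borel_measurable M" and d: "\<And>x. d x \<ge> 0"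
    and r: "r > 0" and L: "L \<ge> 0" and int: "(\<integral>\<^sup>+x. neglog (d x) \<partial>M) \<le> ennreal L"
  shows "ennreal (exp (- r * L)) \<le> (\<integral>\<^sup>+x. ennreal (d x powr r) \<partial>M)"
proof -
  interpret prob_space M by fact
  have "ennreal (exp (- r * L)) + ennreal (exp (- r * L) * (r * L)) = ennreal (exp (- r * L) * (1 + r * L))"
    using r L by (subst ennreal_plus[symmetric]) (auto simp: algebra_simps)
  also have "\<dots> = (\<integral>\<^sup>+x. ennreal (exp (- r * L) * (1 + r * L)) \<partial>M)"
    by (simp add: emeasure_space_1)
  also have "\<dots> \<le> (\<integral>\<^sup>+x. ennreal (d x powr r) + ennreal (exp (- r * L) * r) * neglog (d x) \<partial>M)"
    by (intro nn_integral_mono tangent_powr_neglog r L d)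
  also have "\<dots> = (\<integral>\<^sup>+x. ennreal (d x powr r) \<partial>M) + ennreal (exp (- r * L) * r) * (\<integral>\<^sup>+x. neglog (d x) \<partial>M)"
    by (subst nn_integral_add) (auto simp: nn_integral_cmult)
  also have "\<dots> \<le> (\<integral>\<^sup>+x. ennreal (d x powr r) \<partial>M) + ennreal (exp (- r * L) * r) * ennreal L"
    by (intro add_left_mono mult_left_mono int) auto
  also have "\<dots> = (\<integral>\<^sup>+x. ennreal (d x powr r) \<partial>M) + ennreal (exp (- r * L) * (r * L))"
    using r L by (simp add: mult.assoc flip: ennreal_mult)
  finally show ?thesis by (simp add: ennreal_add_left_cancel_le add.commute)
qed

lemma borel_measurable_infdist [measurable]: "(\<lambda>x::'a::euclidean_space. infdist x A) \<in> borel_measurable borel"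
  by (intro borel_measurable_continuous_onI continuous_intros)

text \<open>Dimension one split into its two halves. One good set of points, from
  \<open>dense\<close>, bounds the errors from above; \<open>spread\<close> bounds them from below
  for all sets at once. It is stated for the logarithm because Jensen's inequality carries that case
  to every r > 0.\<close>

locale one_dimensional_quantization =
  fixes \<nu> :: "'a::euclidean_space measure" and C :: real
  assumes sets_\<nu>: "sets \<nu> = sets borel"
    and prob: "prob_space \<nu>"
    and C_pos: "C > 0"
    and dense: "\<forall>\<^sub>F n in sequentially. \<exists>A. finite A \<and> A \<noteq> {} \<and> card A \<le> n \<and> (AE x in \<nu>. infdist x A \<le> C / real n)"
    and spread: "\<And>\<delta>. \<delta> > 0 \<Longrightarrow> \<forall>\<^sub>F n in sequentially. \<forall>A. finite A \<and> A \<noteq> {} \<and> card A \<le> n \<longrightarrow>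
        (\<integral>\<^sup>+x. neglog (infdist x A) \<partial>\<nu>) \<le> ennreal ((1 + \<delta>) * ln (real n))"
begin

sublocale prob_space \<nu> by (rule prob)

declare sets_\<nu> [measurable_cong]

lemma Vq_upper:
  assumes r: "r > 0"
  shows "\<forall>\<^sub>F n in sequentially. Vq n r \<nu> \<le> ennreal ((C / real n) powr r)"
  using dense
proof eventually_elim
  case (elim n)
  then obtain A where A: "finite A" "A \<noteq> {}" "card A \<le> n" "AE x in \<nu>. infdist x A \<le> C / real n" by blast
  have "Vq n r \<nu> \<le> (\<integral>\<^sup>+x. ennreal (infdist x A powr r) \<partial>\<nu>)"
    unfolding Vq_def by (intro INF_lower) (use A in auto)
  also have "\<dots> \<le> (\<integral>\<^sup>+x. ennreal ((C / real n) powr r) \<partial>\<nu>)"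
    using A(4) r by (intro nn_integral_mono_AE) (auto elim!: eventually_mono intro!: ennreal_leI powr_mono2 infdist_nonneg)
  finally show ?case by (simp add: emeasure_space_1)
qed

lemma Vq_lower:
  assumes r: "r > 0" and \<delta>: "\<delta> > 0"
  shows "\<forall>\<^sub>F n in sequentially. ennreal (exp (- r * ((1 + \<delta>) * ln (real n)))) \<le> Vq n r \<nu>"
  using spread[OF \<delta>] eventually_gt_at_top[of 0]
proof eventually_elim
  case (elim n)
  show ?case unfolding Vq_def
  proof (rule INF_greatest, rule nn_integral_powr_ge_exp_neglog)
    fix A :: "'a set" assume "A \<in> {A. finite A \<and> A \<noteq> {} \<and> card A \<le> n}"
    then show "(\<integral>\<^sup>+x. neglog (infdist x A) \<partial>\<nu>) \<le> ennreal ((1 + \<delta>) * ln (real n))" using elim by blast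
  qed (use r \<delta> elim in \<open>auto simp: infdist_nonneg prob_space_axioms\<close>)
qed

lemma log_en_upper:
  shows "\<forall>\<^sub>F n in sequentially. log_en n \<nu> \<le> ereal (- (ln (real n) - ln C))"
  \<comment> \<open>For n > C almost all distances are below 1, so the positive part of the
    logarithm integrates to 0.\<close>
  using dense eventually_gt_at_top[of "nat \<lceil>C\<rceil>"]
proof eventually_elim
  case (elim n)
  then obtain A where A: "finite A" "A \<noteq> {}" "card A \<le> n" "AE x in \<nu>. infdist x A \<le> C / real n" by blast
  have n: "real n > C" using elim(2) by linarith
  then have C1: "C / real n < 1" and n0: "real n > 0" using C_pos by auto
  have ev: "AE x in \<nu>. ennreal (max 0 (ln (infdist x A))) = 0"
    using A(4)
  proof eventually_elim
    case (elim x)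
    then have "infdist x A \<le> 1" using C1 by linarith
    then have "ln (infdist x A) \<le> 0" using infdist_nonneg[of x A]
      by (cases "infdist x A = 0") auto
    then show ?case by simp
  qed
  have "(\<integral>\<^sup>+x. ennreal (max 0 (ln (infdist x A))) \<partial>\<nu>) = (\<integral>\<^sup>+x. 0 \<partial>\<nu>)"
    by (rule nn_integral_cong_AE[OF ev])
  then have pos: "(\<integral>\<^sup>+x. ennreal (max 0 (ln (infdist x A))) \<partial>\<nu>) = 0" by simp
  have "ennreal (- ln (C / n)) = (\<integral>\<^sup>+x. ennreal (- ln (C / n)) \<partial>\<nu>)" by (simp add: emeasure_space_1)
  also have "\<dots> \<le> (\<integral>\<^sup>+x. neglog (infdist x A) \<partial>\<nu>)"
    using A(4) C_pos n0 by (intro nn_integral_mono_AE) (auto elim!: eventually_mono intro!: neglog_ge infdist_nonneg)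
  finally have "ennreal (ln n - ln C) \<le> (\<integral>\<^sup>+x. neglog (infdist x A) \<partial>\<nu>)"
    using C_pos n0 by (simp add: ln_div)
  then have "enn2ereal (ennreal (ln n - ln C)) \<le> enn2ereal (\<integral>\<^sup>+x. neglog (infdist x A) \<partial>\<nu>)"
    by (simp add: less_eq_ennreal.rep_eq)
  moreover have "ln n - ln C \<ge> 0" using n C_pos by simp
  ultimately have "ereal (ln n - ln C) \<le> enn2ereal (\<integral>\<^sup>+x. neglog (infdist x A) \<partial>\<nu>)"
    by (simp add: enn2ereal_ennreal)
  then have "log_int \<nu> A \<le> ereal (- (ln n - ln C))"
    unfolding log_int_def neglog_def[symmetric] pos
    by (simp add: ereal_uminus_le_reorder flip: zero_ereal_def)
  moreover have "log_en n \<nu> \<le> log_int \<nu> A"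
    unfolding log_en_def by (intro INF_lower) (use A in auto)
  ultimately show ?case by (rule order_trans[rotated])
qed

lemma log_en_lower:
  assumes \<delta>: "\<delta> > 0"
  shows "\<forall>\<^sub>F n in sequentially. ereal (- ((1 + \<delta>) * ln (real n))) \<le> log_en n \<nu>"
  using spread[OF \<delta>] eventually_gt_at_top[of 0]
proof eventually_elim
  case (elim n)
  show ?case unfolding log_en_def
  proof (rule INF_greatest)
    fix A :: "'a set" assume "A \<in> {A. finite A \<and> A \<noteq> {} \<and> card A \<le> n}"
    then have "(\<integral>\<^sup>+x. neglog (infdist x A) \<partial>\<nu>) \<le> ennreal ((1 + \<delta>) * ln (real n))" using elim by blast
    then have "enn2ereal (\<integral>\<^sup>+x. neglog (infdist x A) \<partial>\<nu>) \<le> ereal ((1 + \<delta>) * ln (real n))"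
      using \<delta> elim by (simp add: less_eq_ennreal.rep_eq enn2ereal_ennreal)
    then have "- ereal ((1 + \<delta>) * ln (real n)) \<le> - enn2ereal (\<integral>\<^sup>+x. neglog (infdist x A) \<partial>\<nu>)"
      by (simp only: ereal_minus_le_minus)
    \<comment> \<open>The positive part enters \<open>log_int\<close> through
      \<open>enn2real\<close>, as a nonnegative real, so dropping it only decreases the
      value.\<close>
    also have "\<dots> \<le> log_int \<nu> A"
      unfolding log_int_def neglog_def[symmetric] minus_ereal_def
      by (intro add_increasing) auto
    finally show "ereal (- ((1 + \<delta>) * ln (real n))) \<le> log_int \<nu> A" by simp
  qed
qed

text \<open>Here a n stands for minus the logarithm of the n-th error, divided by r in the case of
  \<open>Vq\<close>. The additive \<open>ln C\<close> and the factor 1 + \<delta> both disappear in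
  the limit.\<close>

lemma tendsto_ratio:
  fixes a :: "nat \<Rightarrow> real"
  assumes up: "\<forall>\<^sub>F n in sequentially. ln (real n) - ln C \<le> a n"
    and low: "\<And>\<delta>. \<delta> > 0 \<Longrightarrow> \<forall>\<^sub>F n in sequentially. a n \<le> (1 + \<delta>) * ln (real n)"
  shows "(\<lambda>n. ln (real n) / a n) \<longlonglongrightarrow> 1"
proof (rule order_tendstoI)
  fix y :: real assume y: "y < 1"
  \<comment> \<open>For y > 0 this makes 1 + \<delta> the midpoint of 1 and 1/y, so that y * (1 +
    \<delta>) < 1; for y \<le> 0 any positive value works.\<close>
  define \<delta> where "\<delta> = (if y \<le> 0 then 1 else (1 / y - 1) / 2)"
  have \<delta>: "\<delta> > 0" using y by (auto simp: \<delta>_def field_simps)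
  have y\<delta>: "y * (1 + \<delta>) < 1"
  proof (cases "y \<le> 0")
    case True then have "y * (1 + \<delta>) \<le> 0" using \<delta> by (intro mult_nonpos_nonneg) auto
    then show ?thesis by simp
  next
    case False then show ?thesis using y by (simp add: \<delta>_def field_simps)
  qed
  have large: "\<forall>\<^sub>F n in sequentially. ln (real n) > max 0 (ln C)"
    using filterlim_compose[OF ln_at_top filterlim_real_sequentially]
    unfolding filterlim_at_top_dense by blast
  show "\<forall>\<^sub>F n in sequentially. y < ln (real n) / a n"
    using up low[OF \<delta>] large
  proof eventually_elim
    case (elim n)
    then have a: "a n > 0" by linarith
    have "y * a n < ln n"
    proof (cases "y \<le> 0")
      case True then have "y * a n \<le> 0" using a by (intro mult_nonpos_nonneg) auto
      then show ?thesis using elim by simp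
    next
      case False
      then have "y * a n \<le> y * ((1 + \<delta>) * ln n)" using elim by (intro mult_left_mono) auto
      also have "\<dots> = (y * (1 + \<delta>)) * ln n" by simp
      also have "\<dots> < 1 * ln n" using y\<delta> elim by (intro mult_strict_right_mono) auto
      finally show ?thesis by simp
    qed
    then show ?case using a by (simp add: field_simps)
  qed
next
  fix y :: real assume y: "1 < y"
  have "\<forall>\<^sub>F n in sequentially. ln (real n) > max (max 0 (ln C)) (y * ln C / (y - 1))"
    using filterlim_compose[OF ln_at_top filterlim_real_sequentially]
    unfolding filterlim_at_top_dense by blast
  then show "\<forall>\<^sub>F n in sequentially. ln (real n) / a n < y"
    using up
  proof eventually_elim
    case (elim n)
    then have a: "a n > 0" by linarith
    have "y * ln C < (y - 1) * ln n" using elim y by (simp add: field_simps)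
    then have "ln n < y * (ln n - ln C)" by (simp add: algebra_simps)
    also have "\<dots> \<le> y * a n" using y elim by (intro mult_left_mono) auto
    finally show ?case using a by (simp add: field_simps)
  qed
qed

lemma has_Dr_1:
  assumes r: "r > 0"
  shows "has_Dr r \<nu> 1"
proof -
  define a where "a = (\<lambda>n. - ln (enn2real (Vq n r \<nu>)) / r)"
  have fin: "\<forall>\<^sub>F n in sequentially. Vq n r \<nu> < \<infinity>"
    using Vq_upper[OF r] by eventually_elim (simp add: order_le_less_trans)
  have pos: "\<forall>\<^sub>F n in sequentially. Vq n r \<nu> > 0"
    using Vq_lower[OF r, of 1] by (auto elim!: eventually_mono intro: less_le_trans[rotated])
  have "\<forall>\<^sub>F n in sequentially. ln (real n) - ln C \<le> a n"
    using Vq_upper[OF r] fin pos eventually_gt_at_top[of 0]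
  proof eventually_elim
    case (elim n)
    have "enn2real (Vq n r \<nu>) \<le> (C / n) powr r" using elim(1) by (intro enn2real_leI) auto
    moreover have "enn2real (Vq n r \<nu>) > 0" using elim by (simp add: enn2real_positive_iff)
    ultimately have "ln (enn2real (Vq n r \<nu>)) \<le> ln ((C / n) powr r)" by (intro ln_mono)
    also have "\<dots> = r * (ln C - ln n)" using C_pos elim by (simp add: ln_powr ln_div)
    finally show ?case using r by (simp add: a_def field_simps)
  qed
  moreover have "\<forall>\<^sub>F n in sequentially. a n \<le> (1 + \<delta>) * ln (real n)" if "\<delta> > 0" for \<delta>
    using Vq_lower[OF r that] fin
  proof eventually_elim
    case (elim n)
    have "exp (- r * ((1 + \<delta>) * ln (real n))) \<le> enn2real (Vq n r \<nu>)"
      using enn2real_mono[OF elim(1)] elim(2) by simp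
    then have "ln (exp (- r * ((1 + \<delta>) * ln (real n)))) \<le> ln (enn2real (Vq n r \<nu>))"
      by (subst ln_le_cancel_iff) (auto intro: less_le_trans[rotated])
    then show ?case using r by (simp add: a_def field_simps)
  qed
  ultimately have "(\<lambda>n. ln (real n) / a n) \<longlonglongrightarrow> 1" by (rule tendsto_ratio)
  moreover have "\<forall>\<^sub>F n in sequentially. ln (real n) / a n = Dr_term r \<nu> n"
    using pos by eventually_elim (auto simp: Dr_term_def a_def)
  ultimately have "Dr_term r \<nu> \<longlonglongrightarrow> 1" by (rule Lim_transform_eventually)
  then show ?thesis using fin by (simp add: has_Dr_def)
qed

lemma has_D0_1: "has_D0 \<nu> 1"
proof -
  define a where "a = (\<lambda>n. - real_of_ereal (log_en n \<nu>))"
  have fin: "\<forall>\<^sub>F n in sequentially. \<bar>log_en n \<nu>\<bar> \<noteq> \<infinity>"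
    using log_en_upper log_en_lower[of 1, simplified] by eventually_elim auto
  have "\<forall>\<^sub>F n in sequentially. ln (real n) - ln C \<le> a n"
    using log_en_upper fin
  proof eventually_elim
    case (elim n) then show ?case by (cases "log_en n \<nu>") (auto simp: a_def)
  qed
  moreover have "\<forall>\<^sub>F n in sequentially. a n \<le> (1 + \<delta>) * ln (real n)" if "\<delta> > 0" for \<delta>
    using log_en_lower[OF that] fin
  proof eventually_elim
    case (elim n) then show ?case by (cases "log_en n \<nu>") (auto simp: a_def)
  qed
  ultimately have "(\<lambda>n. ln (real n) / a n) \<longlonglongrightarrow> 1" by (rule tendsto_ratio)
  moreover have "\<forall>\<^sub>F n in sequentially. ln (real n) / a n = D0_term \<nu> n"
    using fin by eventually_elim (auto simp: D0_term_def a_def)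
  ultimately have "D0_term \<nu> \<longlonglongrightarrow> 1" by (rule Lim_transform_eventually)
  then show ?thesis using fin by (auto simp: has_D0_def elim!: eventually_mono)
qed

end

lemma Dr_eqI: "has_Dr r \<mu> d \<Longrightarrow> Dr r \<mu> = d"
  unfolding Dr_def by (rule the_equality) (auto simp: has_Dr_def intro: LIMSEQ_unique)

lemma D0_eqI: "has_D0 \<mu> d \<Longrightarrow> D0 \<mu> = d"
  unfolding D0_def by (rule the_equality) (auto simp: has_D0_def intro: LIMSEQ_unique)

text \<open>In both constructions the dimension is the same for all r > 0 and for the geometric mean
  error, so the limit as r tends to 0 is that of a constant.\<close>

lemma quantization_dims_tendsto:
  assumes "\<And>r. r > 0 \<Longrightarrow> has_Dr r \<mu> d" "has_D0 \<mu> d"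
  shows "\<forall>\<^sub>F r in at_right 0. \<exists>d. has_Dr r \<mu> d" "\<exists>d. has_D0 \<mu> d" "D0 \<mu> = d"
    "((\<lambda>r. Dr r \<mu>) \<longlongrightarrow> D0 \<mu>) (at_right 0)"
proof -
  show "\<forall>\<^sub>F r in at_right 0. \<exists>d. has_Dr r \<mu> d"
    using eventually_at_right_less[of "0::real"] by eventually_elim (use assms in auto)
  show *: "\<exists>d. has_D0 \<mu> d" "D0 \<mu> = d" using assms D0_eqI by auto
  have "\<forall>\<^sub>F r in at_right 0. d = Dr r \<mu>"
    using eventually_at_right_less[of "0::real"] by eventually_elim (use assms Dr_eqI in metis)
  then show "((\<lambda>r. Dr r \<mu>) \<longlongrightarrow> D0 \<mu>) (at_right 0)"
    unfolding * by (rule Lim_transform_eventually[OF tendsto_const])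
qed

subsection \<open>Random binary digits with zero blocks\<close>

text \<open>The first i digits, most significant first, as an integer: the index of the dyadic cell
  of generation i that contains the value.\<close>

primrec digit_prefix :: "(nat \<Rightarrow> bool) \<Rightarrow> nat \<Rightarrow> nat" where
  "digit_prefix D 0 = 0"
| "digit_prefix D (Suc i) = 2 * digit_prefix D i + of_bool (D i)"

definition digit_value :: "(nat \<Rightarrow> bool) \<Rightarrow> real" where
  "digit_value D = (\<Sum>l. if D l then (1/2) ^ Suc l else 0)"

lemma digit_prefix_inj:
  "digit_prefix D i = digit_prefix D' i \<Longrightarrow> l < i \<Longrightarrow> D l = D' l"
proof (induction i)
  case (Suc i)
  have "2 * digit_prefix D i + of_bool (D i) = 2 * digit_prefix D' i + of_bool (D' i)"
    using Suc.prems by simp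
  then have "D i = D' i \<and> digit_prefix D i = digit_prefix D' i"
    by (cases "D i"; cases "D' i"; simp; presburger)
  then show ?case using Suc by (auto simp: less_Suc_eq)
qed simp

lemma digit_prefix_less: "digit_prefix D i < 2 ^ i"
  by (induction i) (auto simp: of_bool_def)

lemma digit_prefix_eq_sum:
  "real (digit_prefix D i) / 2 ^ i = (\<Sum>l<i. if D l then (1/2) ^ Suc l else 0)"
proof (induction i)
  case (Suc i)
  have "real (digit_prefix D (Suc i)) / 2 ^ Suc i = real (digit_prefix D i) / 2 ^ i + (if D i then (1/2) ^ Suc i else 0)"
    by (simp add: field_simps power_one_over)
  then show ?case using Suc by simp
qed simp

lemma summable_digits: "summable (\<lambda>l. if D l then (1/2) ^ Suc l else (0::real))"
  by (rule summable_comparison_test_ev[OF _ sums_summable[OF power_half_series]]) auto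

lemma digit_value_ge: "real (digit_prefix D i) / 2 ^ i \<le> digit_value D"
  unfolding digit_prefix_eq_sum digit_value_def
  by (intro sum_le_suminf summable_digits) auto

text \<open>A run of zeros from i to j confines the value to an interval of length 2^-j, although
  the prefix leaves only 2^i positions for it; this is where the small Hausdorff dimension comes
  from. For i = j it is the ordinary cell bound.\<close>

lemma digit_value_le:
  assumes "i \<le> j" "\<And>l. i \<le> l \<Longrightarrow> l < j \<Longrightarrow> \<not> D l"
  shows "digit_value D \<le> real (digit_prefix D i) / 2 ^ i + 1 / 2 ^ j"
proof -
  have half: "(\<lambda>l. (1/2) ^ Suc (l + j)) sums (1 / 2 ^ j :: real)"
    using sums_mult[OF power_half_series, of "1 / 2 ^ j"] by (simp add: power_add power_one_over mult_ac)
  have "digit_value D = (\<Sum>l. if D (l + j) then (1/2) ^ Suc (l + j) else 0) + (\<Sum>l<j. if D l then (1/2) ^ Suc l else 0)"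
    unfolding digit_value_def by (rule suminf_split_initial_segment[OF summable_digits])
  also have "(\<Sum>l<j. if D l then (1/2) ^ Suc l else 0) = (\<Sum>l<i. if D l then (1/2) ^ Suc l else (0::real))"
    using assms by (intro sum.mono_neutral_right) (auto simp: not_less)
  also have "(\<Sum>l. if D (l + j) then (1/2) ^ Suc (l + j) else 0) \<le> (\<Sum>l. (1/2) ^ Suc (l + j) :: real)"
    using summable_digits[of D] half
    by (intro suminf_le summable_ignore_initial_segment[where f="\<lambda>l. if D l then (1/2) ^ Suc l else 0"])
       (auto simp: sums_iff)
  also have "\<dots> = 1 / 2 ^ j" using half by (simp add: sums_iff)
  finally show ?thesis by (simp add: digit_prefix_eq_sum)
qed

lemma digit_value_bounds: "0 \<le> digit_value D" "digit_value D \<le> 1"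
  using digit_value_ge[of D 0] digit_value_le[of 0 0 D] by auto

section \<open>Fair coins: mass near a finite set for a fixed set of zeroed digits\<close>

definition coins :: "(nat \<Rightarrow> bool) measure" where
  "coins = PiM UNIV (\<lambda>_. measure_pmf (bernoulli_pmf (1/2)))"

interpretation coins: prob_space coins
  unfolding coins_def by (intro prob_space_PiM) (rule measure_pmf.prob_space_axioms)

lemma measurable_coin [measurable]: "(\<lambda>b. b l) \<in> measurable coins (count_space UNIV)"
  unfolding coins_def by measurable

lemma space_coins [simp]: "space coins = UNIV"
  by (simp add: coins_def space_PiM)

lemma measurable_digit_prefix [measurable]:
  assumes [measurable]: "\<And>l. Measurable.pred M (\<lambda>x. D x l)"
  shows "(\<lambda>x. digit_prefix (D x) i) \<in> measurable M (count_space UNIV)"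
  by (induction i) (simp_all add: of_bool_def)

lemma measurable_digit_value [measurable]:
  assumes [measurable]: "\<And>l. Measurable.pred M (\<lambda>x. D x l)"
  shows "(\<lambda>x. digit_value (D x)) \<in> borel_measurable M"
  unfolding digit_value_def by measurable

lemma emeasure_coins_agree:
  assumes "finite F"
  shows "emeasure coins {b. \<forall>l\<in>F. b l = D l} = ennreal ((1/2) ^ card F)"
proof -
  interpret product_prob_space "\<lambda>_. measure_pmf (bernoulli_pmf (1/2))" "UNIV :: nat set" ..
  have "emeasure coins {b. \<forall>l\<in>F. b l = D l} =
     emeasure (PiM UNIV (\<lambda>_. measure_pmf (bernoulli_pmf (1/2)))) {b \<in> space (PiM UNIV (\<lambda>_. measure_pmf (bernoulli_pmf (1/2)))). \<forall>l\<in>F. b l \<in> {D l}}"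
    by (simp add: coins_def space_PiM)
  also have "\<dots> = (\<Prod>l\<in>F. emeasure (measure_pmf (bernoulli_pmf (1/2))) {D l})"
    by (rule emeasure_PiM_Collect) (use assms in auto)
  also have "\<dots> = ennreal ((1/2) ^ card F)"
    by (simp only: emeasure_pmf_single pmf_bernoulli_half prod_constant) (rule ennreal_power, simp)
  finally show ?thesis .
qed

text \<open>A prefix determines each of its free digits, and those are independent fair coins. The
  target z is an integer rather than a natural number because cells next to a point may have
  negative index.\<close>

lemma emeasure_digit_prefix_le:
  "emeasure coins {b. int (digit_prefix (\<lambda>l. b l \<and> l \<notin> S) i) = z} \<le> ennreal ((1/2) ^ card ({..<i} - S))"
proof (cases "\<exists>b. int (digit_prefix (\<lambda>l. b l \<and> l \<notin> S) i) = z")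
  case True
  then obtain D where D: "int (digit_prefix (\<lambda>l. D l \<and> l \<notin> S) i) = z" by blast
  have meas: "{b. \<forall>l\<in>{..<i} - S. b l = D l} \<in> sets coins"
  proof -
    have "{b \<in> space coins. \<forall>l\<in>{..<i} - S. b l = D l} \<in> sets coins" by measurable
    then show ?thesis by simp
  qed
  have "{b. int (digit_prefix (\<lambda>l. b l \<and> l \<notin> S) i) = z} \<subseteq> {b. \<forall>l\<in>{..<i} - S. b l = D l}"
  proof (intro subsetI CollectI ballI)
    fix b l assume b: "b \<in> {b. int (digit_prefix (\<lambda>l. b l \<and> l \<notin> S) i) = z}" and l: "l \<in> {..<i} - S"
    have "digit_prefix (\<lambda>l. b l \<and> l \<notin> S) i = digit_prefix (\<lambda>l. D l \<and> l \<notin> S) i" using b D by auto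
    from digit_prefix_inj[OF this, of l] l show "b l = D l" by simp
  qed
  then have "emeasure coins {b. int (digit_prefix (\<lambda>l. b l \<and> l \<notin> S) i) = z} \<le> emeasure coins {b. \<forall>l\<in>{..<i} - S. b l = D l}"
    using meas by (rule emeasure_mono)
  then show ?thesis by (simp add: emeasure_coins_agree)
qed simp

text \<open>A union bound: being within 2^-i of a point of A leaves four candidate cells of
  generation i for that point, and the free digits bound the mass of each.\<close>

lemma emeasure_coins_infdist_le:
  assumes A: "finite A" "A \<noteq> {}" "card A \<le> n"
  shows "emeasure coins {b. infdist (digit_value (\<lambda>l. b l \<and> l \<notin> S)) A \<le> (1/2) ^ i}
     \<le> ennreal (4 * real n * (1/2) ^ card ({..<i} - S))"
proof -
  \<comment> \<open>If p is the prefix and v the value, then p \<le> 2^i v \<le> p + 1 and v is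
    within 2^-i of a, so p lies between 2^i a - 2 and 2^i a + 1; taking the floor leaves these four
    integers.\<close>
  define I where "I = (SIGMA a:A. {\<lfloor>2 ^ i * a\<rfloor> - 2..\<lfloor>2 ^ i * a\<rfloor> + 1})"
  define T where "T = (\<lambda>p::real \<times> int. {b. int (digit_prefix (\<lambda>l. b l \<and> l \<notin> S) i) = snd p})"
  have T[measurable]: "T p \<in> sets coins" for p
  proof -
    have "{b\<in>space coins. int (digit_prefix (\<lambda>l. b l \<and> l \<notin> S) i) = snd p} \<in> sets coins" by measurable
    then show ?thesis by (simp add: T_def)
  qed
  have fin: "finite I" unfolding I_def using A by auto
  have card: "card I = card A * 4"
    unfolding I_def by (subst card_SigmaI) (use A in auto)
  have "{b. infdist (digit_value (\<lambda>l. b l \<and> l \<notin> S)) A \<le> (1/2) ^ i} \<subseteq> (\<Union>p\<in>I. T p)"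
  proof
    fix b assume "b \<in> {b. infdist (digit_value (\<lambda>l. b l \<and> l \<notin> S)) A \<le> (1/2) ^ i}"
    then have b: "infdist (digit_value (\<lambda>l. b l \<and> l \<notin> S)) A \<le> (1/2) ^ i" by simp
    define v p where "v = digit_value (\<lambda>l. b l \<and> l \<notin> S)" and "p = digit_prefix (\<lambda>l. b l \<and> l \<notin> S) i"
    obtain a where a: "a \<in> A" "infdist v A = dist v a"
      using infdist_attains_inf[of A v] A finite_imp_closed by blast
    then have "\<bar>v - a\<bar> \<le> 1 / 2 ^ i" using b by (simp add: v_def dist_real_def power_one_over)
    then have "2 ^ i * \<bar>v - a\<bar> \<le> 1" by (simp add: field_simps)
    then have "\<bar>2 ^ i * v - 2 ^ i * a\<bar> \<le> 1" by (simp add: abs_mult flip: right_diff_distrib)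
    moreover have "real p / 2 ^ i \<le> v" "v \<le> real p / 2 ^ i + 1 / 2 ^ i"
      using digit_value_ge digit_value_le[of i i] by (auto simp: v_def p_def)
    then have "real p \<le> 2 ^ i * v" "2 ^ i * v \<le> real p + 1"
      by (auto simp: field_simps)
    ultimately have "int p \<in> {\<lfloor>2 ^ i * a\<rfloor> - 2..\<lfloor>2 ^ i * a\<rfloor> + 1}"
      by (simp; linarith)
    then have "(a, int p) \<in> I" "b \<in> T (a, int p)" using a by (auto simp: I_def T_def p_def)
    then show "b \<in> (\<Union>p\<in>I. T p)" by blast
  qed
  then have "emeasure coins {b. infdist (digit_value (\<lambda>l. b l \<and> l \<notin> S)) A \<le> (1/2) ^ i} \<le> emeasure coins (\<Union>p\<in>I. T p)"
    by (rule emeasure_mono) (use fin T in auto)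
  also have "\<dots> \<le> (\<Sum>p\<in>I. emeasure coins (T p))"
    by (rule emeasure_subadditive_finite) (use fin T in auto)
  also have "\<dots> \<le> (\<Sum>p\<in>I. ennreal ((1/2) ^ card ({..<i} - S)))"
    unfolding T_def by (intro sum_mono emeasure_digit_prefix_le)
  also have "\<dots> = ennreal (4 * real (card A) * (1/2) ^ card ({..<i} - S))"
    by (simp add: card ennreal_mult'' mult.commute flip: ennreal_of_nat_eq_real_of_nat)
  also have "\<dots> \<le> ennreal (4 * real n * (1/2) ^ card ({..<i} - S))"
    using A by (intro ennreal_leI mult_right_mono) auto
  finally show ?thesis .
qed

text \<open>For \<open>u \<in> [1, 2)\<close> the integers \<open>\<lfloor>2\<^sup>g u\<rfloor>\<close> sweep through the dyadic generations: every \<open>u\<close> zeroes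
  infinitely many blocks \<open>[4\<^sup>c, 2 \<cdot> 4\<^sup>c)\<close>, but a given block is zeroed only for \<open>u\<close> in an interval of
  length at most \<open>2 / c\<close>.\<close>

definition zero_digits :: "real \<Rightarrow> nat set" where
  "zero_digits u = {l. \<exists>g. 4 ^ nat \<lfloor>2 ^ g * u\<rfloor> \<le> l \<and> l < 2 * 4 ^ nat \<lfloor>2 ^ g * u\<rfloor>}"

text \<open>Block c ends at \<open>2 * 4 ^ c\<close>, before block c + 1 starts at
  \<open>4 ^ (c + 1)\<close>, so the blocks are disjoint.\<close>

lemma pow4_block_unique:
  fixes l c d :: nat
  assumes "4 ^ c \<le> l" "l < 2 * 4 ^ c" "4 ^ d \<le> l" "l < 2 * 4 ^ d"
  shows "c = d"
proof -
  have "\<not> c < d" if "4 ^ d \<le> l" "l < 2 * 4 ^ c" for c d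
  proof
    assume "c < d"
    then have "(4::nat) ^ Suc c \<le> 4 ^ d" by (intro power_increasing) auto
    then show False using that by simp
  qed
  then show ?thesis using assms by (metis nat_neq_iff)
qed

text \<open>If \<open>l div 2\<close> lies in block d, then l lies between \<open>2 * 4 ^ d\<close>
  and \<open>4 ^ (d + 1)\<close>, which is the gap between blocks d and d + 1. The base 4 is chosen
  to leave this gap.\<close>

lemma pow4_block_half:
  fixes l c d :: nat
  assumes "4 ^ c \<le> l" "l < 2 * 4 ^ c" "4 ^ d \<le> l div 2" "l div 2 < 2 * 4 ^ d"
  shows False
proof -
  have "l < 4 ^ Suc d" "2 * 4 ^ d \<le> l" using assms by auto
  then have "(4::nat) ^ c < 4 ^ Suc d" "(4::nat) ^ d < 4 ^ c" using assms by linarith+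
  then have "c < Suc d" "d < c" by (auto intro: power_less_imp_less_exp[of "4::nat"] simp del: power_Suc)
  then show False by simp
qed

text \<open>Halving maps the zeroed digits two-to-one into the free ones.\<close>

lemma card_free_digits: "i \<le> 3 * card ({..<i} - zero_digits u)"
proof -
  let ?Z = "{..<i} \<inter> zero_digits u" and ?F = "{..<i} - zero_digits u"
  have "?Z \<subseteq> (\<Union>m\<in>?F. {2 * m, 2 * m + 1})"
  proof
    fix l assume l: "l \<in> ?Z"
    then obtain g where "4 ^ nat \<lfloor>2 ^ g * u\<rfloor> \<le> l" "l < 2 * 4 ^ nat \<lfloor>2 ^ g * u\<rfloor>" by (auto simp: zero_digits_def)
    then have "l div 2 \<notin> zero_digits u" by (auto simp: zero_digits_def dest: pow4_block_half)
    moreover have "l div 2 < i" using l by auto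
    moreover have "l \<in> {2 * (l div 2), 2 * (l div 2) + 1}" by auto
    ultimately show "l \<in> (\<Union>m\<in>?F. {2 * m, 2 * m + 1})" by blast
  qed
  then have "card ?Z \<le> card (\<Union>m\<in>?F. {2 * m, 2 * m + 1})" by (intro card_mono) auto
  also have "\<dots> \<le> (\<Sum>m\<in>?F. card {2 * m, 2 * m + 1})" by (intro card_UN_le) auto
  also have "\<dots> = 2 * card ?F" by simp
  finally have "card ?Z \<le> 2 * card ?F" .
  moreover have "card ?Z + card ?F = i"
    using card_Int_Diff[of "{..<i}" "zero_digits u"] by simp
  ultimately show ?thesis by linarith
qed

section \<open>Rarity of zeroed digits when u is uniform on [1, 2)\<close>

definition unif :: "real measure" where "unif = uniform_measure lborel {1..<2}"

interpretation unif: prob_space unif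
  unfolding unif_def by (intro prob_space_uniform_measure) auto

lemma sets_unif [measurable_cong, simp]: "sets unif = sets borel"
  by (simp add: unif_def)

lemma space_unif [simp]: "space unif = UNIV"
  by (simp add: unif_def)

lemma AE_unif: "AE u in unif. 1 \<le> u \<and> u < 2"
  unfolding unif_def by (intro AE_uniform_measureI) auto

lemma pred_zero_digits [measurable]: "Measurable.pred borel (\<lambda>u. l \<in> zero_digits u)"
  unfolding zero_digits_def by measurable

text \<open>The digit l lies in at most one block c, and c is attained in only one generation h, the
  one with 2^h \<le> c < 2^(h+1). So u is confined to an interval of length 2^-h, and a large l
  forces a large h.\<close>

lemma emeasure_zero_digit_le:
  assumes l: "2 * 4 ^ 2 ^ G \<le> l"
  shows "emeasure unif {u. l \<in> zero_digits u} \<le> ennreal ((1/2) ^ G)"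
proof (cases "{u. l \<in> zero_digits u} \<inter> {1..<2} = {}")
  case True
  then show ?thesis
    by (simp add: unif_def emeasure_uniform_measure Int_commute)
next
  case False
  then obtain v :: real and h where v: "1 \<le> v" "v < 2" and h: "4 ^ nat \<lfloor>2 ^ h * v\<rfloor> \<le> l" "l < 2 * 4 ^ nat \<lfloor>2 ^ h * v\<rfloor>"
    by (auto simp: zero_digits_def)
  define c where "c = \<lfloor>2 ^ h * v\<rfloor>"
  \<comment> \<open>On [1, 2) generation g produces only block indices in [2^g, 2^(g+1)), so the
    index reveals the generation.\<close>
  have bounds: "2 ^ g \<le> \<lfloor>2 ^ g * u\<rfloor>" "\<lfloor>2 ^ g * u\<rfloor> < 2 ^ Suc g" if "1 \<le> u" "u < 2" for u :: real and g
  proof -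
    have "of_int (2 ^ g) \<le> 2 ^ g * u" "2 ^ g * u < of_int (2 ^ Suc g)" using that by auto
    then show "2 ^ g \<le> \<lfloor>2 ^ g * u\<rfloor>" "\<lfloor>2 ^ g * u\<rfloor> < 2 ^ Suc g"
      by (simp_all only: le_floor_iff floor_less_iff)
  qed
  have "{u. l \<in> zero_digits u} \<inter> {1..<2} \<subseteq> {c / 2 ^ h..(c + 1) / 2 ^ h}"
  proof
    fix u assume "u \<in> {u. l \<in> zero_digits u} \<inter> {1..<2}"
    then obtain g where u: "1 \<le> u" "u < 2" and g: "4 ^ nat \<lfloor>2 ^ g * u\<rfloor> \<le> l" "l < 2 * 4 ^ nat \<lfloor>2 ^ g * u\<rfloor>"
      by (auto simp: zero_digits_def)
    have "nat \<lfloor>2 ^ g * u\<rfloor> = nat \<lfloor>2 ^ h * v\<rfloor>" by (rule pow4_block_unique[OF g h])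
    moreover have "\<lfloor>2 ^ g * u\<rfloor> \<ge> 0" "\<lfloor>2 ^ h * v\<rfloor> \<ge> 0" using u v by auto
    ultimately have eq: "\<lfloor>2 ^ g * u\<rfloor> = c" unfolding c_def by (simp only: eq_nat_nat_iff)
    have "(2::int) ^ g < 2 ^ Suc h" "(2::int) ^ h < 2 ^ Suc g"
      using bounds[OF u, of g] bounds[OF v, of h] eq unfolding c_def by linarith+
    then have "g < Suc h" "h < Suc g" by (auto intro: power_less_imp_less_exp[of "2::int"] simp del: power_Suc)
    then have "g = h" by simp
    then have "\<lfloor>2 ^ h * u\<rfloor> = c" using eq by simp
    then have "of_int c \<le> 2 ^ h * u" "2 ^ h * u \<le> of_int c + 1" by linarith+
    then show "u \<in> {c / 2 ^ h..(c + 1) / 2 ^ h}" by (simp add: field_simps)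
  qed
  then have "emeasure lborel ({u. l \<in> zero_digits u} \<inter> {1..<2}) \<le> emeasure lborel {c / 2 ^ h..(c + 1) / 2 ^ h}"
    by (rule emeasure_mono) auto
  also have "\<dots> = ennreal ((1/2) ^ h)"
    by (simp add: add_divide_distrib power_one_over divide_right_mono)
  also have "\<dots> \<le> ennreal ((1/2) ^ G)"
  proof (intro ennreal_leI power_decreasing)
    \<comment> \<open>From \<open>2 * 4 ^ 2 ^ G \<le> l < 2 * 4 ^ c\<close> one gets c > 2^G, and c
      < 2^(h+1) then gives G \<le> h.\<close>
    have "(4::nat) ^ 2 ^ G < 4 ^ nat c" using l h unfolding c_def by linarith
    then have "2 ^ G < nat c" by (rule power_less_imp_less_exp[rotated]) simp
    then have "2 ^ G < c" by (simp add: zless_nat_eq_int_zless)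
    then have "(2::int) ^ G < 2 ^ Suc h" using bounds[OF v, of h] unfolding c_def by linarith
    then have "G < Suc h" by (rule power_less_imp_less_exp[rotated]) simp
    then show "G \<le> h" by simp
  qed auto
  finally show ?thesis
    by (simp add: unif_def emeasure_uniform_measure Int_commute divide_ennreal_def)
qed

lemma cesaro_null:
  fixes q :: "nat \<Rightarrow> real"
  assumes q: "q \<longlonglongrightarrow> 0"
  shows "(\<lambda>n. (\<Sum>l<n. q l) / real n) \<longlonglongrightarrow> 0"
proof (rule LIMSEQ_I)
  fix e :: real assume e: "e > 0"
  obtain N where N: "\<And>l. l \<ge> N \<Longrightarrow> \<bar>q l\<bar> < e / 2"
    using LIMSEQ_D[OF q, of "e / 2"] e by auto
  define K where "K = (\<Sum>l<N. \<bar>q l\<bar>)"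
  obtain M :: nat where M: "2 * K / e < real M" using reals_Archimedean2 by blast
  have "norm ((\<Sum>l<n. q l) / real n - 0) < e" if n: "n \<ge> max (Suc N) M" for n
  proof -
    have n0: "real n > 0" using n by simp
    have "\<bar>\<Sum>l<n. q l\<bar> \<le> (\<Sum>l<n. \<bar>q l\<bar>)" by (rule sum_abs)
    also have "\<dots> = K + (\<Sum>l\<in>{N..<n}. \<bar>q l\<bar>)"
      unfolding K_def using n by (subst sum.union_disjoint[symmetric]) (auto intro!: sum.cong)
    also have "(\<Sum>l\<in>{N..<n}. \<bar>q l\<bar>) \<le> (\<Sum>l\<in>{N..<n}. e / 2)"
      using N by (intro sum_mono less_imp_le) auto
    also have "\<dots> \<le> real n * (e / 2)" using e by (simp add: field_simps)
    finally have *: "\<bar>\<Sum>l<n. q l\<bar> \<le> K + real n * (e / 2)" by simp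
    have "2 * K / e < real n" using M n by linarith
    then have "K < real n * (e / 2)" using e by (simp add: field_simps)
    then have "\<bar>\<Sum>l<n. q l\<bar> < e * real n" using * by (simp add: field_simps)
    then show ?thesis using n0 by (simp add: field_simps)
  qed
  then show "\<exists>no. \<forall>n\<ge>no. norm ((\<Sum>l<n. q l) / real n - 0) < e" by blast
qed

lemma zero_digit_prob_tendsto: "(\<lambda>l. measure unif {u. l \<in> zero_digits u}) \<longlonglongrightarrow> 0"
proof (rule LIMSEQ_I)
  fix e :: real assume e: "e > 0"
  obtain G where G: "(1/2) ^ G < e" using real_arch_pow_inv[OF e, of "1/2"] by auto
  have "norm (measure unif {u. l \<in> zero_digits u} - 0) < e" if "l \<ge> 2 * 4 ^ 2 ^ G" for l
  proof -
    have "measure unif {u. l \<in> zero_digits u} \<le> (1/2) ^ G"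
      using emeasure_zero_digit_le[OF that] by (simp add: unif.emeasure_eq_measure)
    then show ?thesis using G by simp
  qed
  then show "\<exists>no. \<forall>l\<ge>no. norm (measure unif {u. l \<in> zero_digits u} - 0) < e" by blast
qed

lemma measurable_card_zero_digits [measurable]:
  "(\<lambda>u. real (card ({..<i} \<inter> zero_digits u))) \<in> borel_measurable borel"
proof -
  have "real (card ({..<i} \<inter> zero_digits u)) = (\<Sum>l<i. if l \<in> zero_digits u then 1 else 0)" for u
    by (simp add: sum.If_cases Int_commute)
  then show ?thesis by simp
qed

text \<open>Markov's inequality: the expected number of zeroed digits below i is a sum of
  probabilities that tend to 0, hence o(i).\<close>

lemma many_zero_digits_small:
  assumes \<theta>: "\<theta> > 0" and \<delta>: "\<delta> > 0"
  shows "\<forall>\<^sub>F i in sequentially. emeasure unif {u. real (card ({..<i} \<inter> zero_digits u)) > \<theta> * real i} \<le> ennreal \<delta>"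
proof -
  let ?q = "\<lambda>l. measure unif {u. l \<in> zero_digits u}"
  have "\<forall>\<^sub>F i in sequentially. (\<Sum>l<i. ?q l) / real i < \<theta> * \<delta>"
    using cesaro_null[OF zero_digit_prob_tendsto] assms by (intro order_tendstoD(2)) auto
  then show ?thesis using eventually_gt_at_top[of 0]
  proof eventually_elim
    case (elim i)
    have meas: "{u. l \<in> zero_digits u} \<in> sets borel" for l
      using pred_zero_digits[of l] by (simp add: pred_def)
    have "emeasure unif {u. real (card ({..<i} \<inter> zero_digits u)) > \<theta> * real i}
       = (\<integral>\<^sup>+u. indicator {u. real (card ({..<i} \<inter> zero_digits u)) > \<theta> * real i} u \<partial>unif)"
      by (subst nn_integral_indicator) auto
    also have "\<dots> \<le> (\<integral>\<^sup>+u. ennreal (1 / (\<theta> * i)) * (\<Sum>l<i. indicator {u. l \<in> zero_digits u} u) \<partial>unif)"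
    proof (rule nn_integral_mono)
      fix u
      have *: "(\<Sum>l<i. indicator {u. l \<in> zero_digits u} u) = ennreal (real (card ({..<i} \<inter> zero_digits u)))"
        by (simp add: indicator_def sum.If_cases Int_commute ennreal_of_nat_eq_real_of_nat)
      show "indicator {u. real (card ({..<i} \<inter> zero_digits u)) > \<theta> * real i} u
         \<le> ennreal (1 / (\<theta> * i)) * (\<Sum>l<i. indicator {u. l \<in> zero_digits u} u)"
      proof (cases "real (card ({..<i} \<inter> zero_digits u)) > \<theta> * real i")
        case True
        then have "1 \<le> 1 / (\<theta> * i) * real (card ({..<i} \<inter> zero_digits u))" using \<theta> elim by (simp add: field_simps)
        then have "ennreal 1 \<le> ennreal (1 / (\<theta> * i)) * ennreal (real (card ({..<i} \<inter> zero_digits u)))"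
          using \<theta> by (subst ennreal_mult[symmetric]) (auto intro!: ennreal_leI)
        then show ?thesis unfolding * using True by simp
      qed simp
    qed
    also have "\<dots> = ennreal (1 / (\<theta> * i)) * (\<Sum>l<i. ennreal (?q l))"
      using meas by (simp add: nn_integral_cmult nn_integral_sum unif.emeasure_eq_measure)
    also have "\<dots> = ennreal (1 / (\<theta> * i) * (\<Sum>l<i. ?q l))"
      using \<theta> by (subst sum_ennreal, simp, subst ennreal_mult[symmetric]) (auto simp: sum_nonneg)
    also have "\<dots> \<le> ennreal \<delta>"
      using elim \<theta> by (intro ennreal_leI) (simp add: field_simps)
    finally show ?case .
  qed
qed

section \<open>The law of the random number: mass near finite sets and logarithmic integrals\<close>

definition digit_law :: "real measure" where
  "digit_law = distr (unif \<Otimes>\<^sub>M coins) borel (\<lambda>(u, b). digit_value (\<lambda>l. b l \<and> l \<notin> zero_digits u))"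

lemma measurable_digit_map [measurable]:
  "(\<lambda>(u, b). digit_value (\<lambda>l. b l \<and> l \<notin> zero_digits u)) \<in> borel_measurable (unif \<Otimes>\<^sub>M coins)"
  by measurable

interpretation unif_coins: pair_prob_space unif coins ..

interpretation digit_law: prob_space digit_law
  unfolding digit_law_def by (intro unif_coins.prob_space_distr) measurable

lemma sets_digit_law [measurable_cong, simp]: "sets digit_law = sets borel"
  by (simp add: digit_law_def)

lemma AE_digit_law_unit: "AE y in digit_law. 0 \<le> y \<and> y \<le> 1"
  unfolding digit_law_def
  by (subst AE_distr_iff) (auto simp: digit_value_bounds)

text \<open>Once u is fixed the zeroed positions are fixed too, so the bounds for the coins can be
  integrated over u.\<close>

lemma emeasure_digit_law_infdist:
  "emeasure digit_law {y. infdist y A \<le> (1/2) ^ i}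
     = (\<integral>\<^sup>+u. emeasure coins {b. infdist (digit_value (\<lambda>l. b l \<and> l \<notin> zero_digits u)) A \<le> (1/2) ^ i} \<partial>unif)"
proof -
  have "emeasure digit_law {y. infdist y A \<le> (1/2) ^ i}
    = emeasure (unif \<Otimes>\<^sub>M coins) ((\<lambda>(u, b). digit_value (\<lambda>l. b l \<and> l \<notin> zero_digits u)) -` {y. infdist y A \<le> (1/2) ^ i} \<inter> space (unif \<Otimes>\<^sub>M coins))"
    unfolding digit_law_def by (rule emeasure_distr) auto
  also have "\<dots> = (\<integral>\<^sup>+u. emeasure coins (Pair u -` ((\<lambda>(u, b). digit_value (\<lambda>l. b l \<and> l \<notin> zero_digits u)) -` {y. infdist y A \<le> (1/2) ^ i} \<inter> space (unif \<Otimes>\<^sub>M coins))) \<partial>unif)"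
    by (rule coins.emeasure_pair_measure_alt, rule measurable_sets[OF measurable_digit_map]) auto
  finally show ?thesis by (simp add: vimage_def space_pair_measure)
qed

text \<open>Holds for every zero pattern, without an exceptional set; meant for the scales i beyond
  3 log2 n, where it decays geometrically.\<close>

lemma emeasure_digit_law_infdist_le_third:
  assumes A: "finite A" "A \<noteq> {}" "card A \<le> n"
  shows "emeasure digit_law {y. infdist y A \<le> (1/2) ^ i} \<le> ennreal (4 * real n * 2 powr (- (i / 3)))"
proof -
  have "emeasure coins {b. infdist (digit_value (\<lambda>l. b l \<and> l \<notin> zero_digits u)) A \<le> (1/2) ^ i} \<le> ennreal (4 * real n * 2 powr (- (i / 3)))" for u
  proof -
    have "real i / 3 \<le> card ({..<i} - zero_digits u)" using card_free_digits[of i u] by linarith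
    then have "2 powr (- real (card ({..<i} - zero_digits u))) \<le> 2 powr (- (i / 3))" by (intro powr_mono) auto
    then have "(1/2) ^ card ({..<i} - zero_digits u) \<le> 2 powr (- (i / 3))"
      by (simp add: powr_minus powr_realpow power_one_over inverse_eq_divide)
    then show ?thesis
      by (intro order_trans[OF emeasure_coins_infdist_le[OF A]] ennreal_leI mult_left_mono) auto
  qed
  then have "emeasure digit_law {y. infdist y A \<le> (1/2) ^ i} \<le> (\<integral>\<^sup>+u. ennreal (4 * real n * 2 powr (- (i / 3))) \<partial>unif)"
    unfolding emeasure_digit_law_infdist by (intro nn_integral_mono) auto
  then show ?thesis using unif.emeasure_space_1 by simp
qed

text \<open>Exceptional u contribute at most their probability \<delta>; for all others at least a *
  i of the first i digits are free. The decay rate a near 1 is what makes the leading constant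
  1.\<close>

lemma emeasure_digit_law_infdist_le:
  assumes A: "finite A" "A \<noteq> {}" "card A \<le> n"
    and small: "emeasure unif {u. real (card ({..<i} \<inter> zero_digits u)) > (1 - a) * real i} \<le> ennreal \<delta>"
    and \<delta>: "\<delta> \<ge> 0"
  shows "emeasure digit_law {y. infdist y A \<le> (1/2) ^ i} \<le> ennreal (\<delta> + 4 * real n * 2 powr (- (a * i)))"
proof -
  let ?B = "{u. real (card ({..<i} \<inter> zero_digits u)) > (1 - a) * real i}"
  let ?c = "ennreal (4 * real n * 2 powr (- (a * i)))"
  have "emeasure coins {b. infdist (digit_value (\<lambda>l. b l \<and> l \<notin> zero_digits u)) A \<le> (1/2) ^ i} \<le> indicator ?B u + ?c" for u
  proof (cases "u \<in> ?B")
    case True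
    then show ?thesis using coins.emeasure_le_1 by (simp add: add_increasing2)
  next
    case False
    have "card ({..<i} \<inter> zero_digits u) + card ({..<i} - zero_digits u) = i"
      using card_Int_Diff[of "{..<i}" "zero_digits u"] by simp
    then have "real (card ({..<i} \<inter> zero_digits u)) + real (card ({..<i} - zero_digits u)) = real i"
      by (metis of_nat_add)
    then have "a * i \<le> card ({..<i} - zero_digits u)" using False by (simp add: algebra_simps)
    then have "2 powr (- real (card ({..<i} - zero_digits u))) \<le> 2 powr (- (a * i))" by (intro powr_mono) auto
    then have "(1/2) ^ card ({..<i} - zero_digits u) \<le> 2 powr (- (a * i))"
      by (simp add: powr_minus powr_realpow power_one_over inverse_eq_divide)
    then have "emeasure coins {b. infdist (digit_value (\<lambda>l. b l \<and> l \<notin> zero_digits u)) A \<le> (1/2) ^ i} \<le> ?c"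
      by (intro order_trans[OF emeasure_coins_infdist_le[OF A]] ennreal_leI mult_left_mono) auto
    then show ?thesis using False by simp
  qed
  then have "emeasure digit_law {y. infdist y A \<le> (1/2) ^ i} \<le> (\<integral>\<^sup>+u. indicator ?B u + ?c \<partial>unif)"
    unfolding emeasure_digit_law_infdist by (intro nn_integral_mono) auto
  also have "\<dots> = emeasure unif ?B + ?c"
    using unif.emeasure_space_1 by (subst nn_integral_add) auto
  also have "\<dots> \<le> ennreal \<delta> + ?c" by (intro add_right_mono small)
  also have "\<dots> = ennreal (\<delta> + 4 * real n * 2 powr (- (a * i)))" using \<delta> by simp
  finally show ?thesis .
qed

text \<open>A dyadic layer-cake bound: at least - log2 d of the scales 2^-i, counted from i = 0, are
  no smaller than d. It turns the logarithmic integral into a sum of masses of neighbourhoods of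
  A.\<close>

lemma neglog_le_sum:
  assumes d: "d \<ge> 0"
  shows "neglog d \<le> ennreal (ln 2) * (\<Sum>i. indicator {x. x \<le> (1/2) ^ i} d)"
proof (cases "d = 0")
  case True
  have "(\<Sum>i. 1 :: ennreal) = \<infinity>"
  proof (rule ccontr)
    assume "(\<Sum>i. 1 :: ennreal) \<noteq> \<infinity>"
    then obtain r where r: "r \<ge> 0" "(\<Sum>i. 1 :: ennreal) = ennreal r"
      by (cases "(\<Sum>i. 1 :: ennreal)") auto
    obtain k :: nat where k: "r < real k" using reals_Archimedean2 by blast
    have "ennreal (real k) = (\<Sum>i<k. 1 :: ennreal)" by (simp add: ennreal_of_nat_eq_real_of_nat)
    also have "\<dots> \<le> ennreal r" unfolding r(2)[symmetric] by (intro sum_le_suminf) auto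
    finally show False using k r by simp
  qed
  then show ?thesis using True by (simp add: ennreal_mult_top)
next
  case False
  then have d0: "d > 0" using d by simp
  show ?thesis
  proof (cases "d \<ge> 1")
    case True
    then show ?thesis by (simp add: neglog_def)
  next
    case False
    \<comment> \<open>Rounding up is harmless: i \<le> k - 1 < - log2 d for each of the k scales 0,
      ..., k - 1, so all of them count.\<close>
    define k where "k = nat \<lceil>- log 2 d\<rceil>"
    have pos: "- log 2 d > 0" using False d0 by simp
    have k: "- log 2 d \<le> real k" "real k < - log 2 d + 1" unfolding k_def using pos by linarith+
    have ind: "indicator {x. x \<le> (1/2) ^ i} d = (1 :: ennreal)" if "i < k" for i
    proof -
      have "real i \<le> - log 2 d" using that k by linarith
      then have "log 2 d \<le> - real i" by simp
      then have "d \<le> 2 powr (- real i)" using d0 by (simp add: log_le_iff)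
      then show ?thesis by (simp add: powr_minus powr_realpow power_one_over inverse_eq_divide)
    qed
    have "neglog d = ennreal (- ln d)" using d0 False by (simp add: neglog_def)
    also have "\<dots> \<le> ennreal (ln 2 * real k)"
    proof (rule ennreal_leI)
      have "- ln d = ln 2 * (- log 2 d)" by (simp add: log_def)
      also have "\<dots> \<le> ln 2 * real k" using k by (intro mult_left_mono) auto
      finally show "- ln d \<le> ln 2 * real k" .
    qed
    also have "\<dots> = ennreal (ln 2) * (\<Sum>i<k. indicator {x. x \<le> (1/2) ^ i} d)"
      by (simp add: ind ennreal_mult ennreal_of_nat_eq_real_of_nat)
    also have "\<dots> \<le> ennreal (ln 2) * (\<Sum>i. indicator {x. x \<le> (1/2) ^ i} d)"
      by (intro mult_left_mono sum_le_suminf) auto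
    finally show ?thesis .
  qed
qed

lemma suminf_count_le:
  assumes "x \<ge> 0" and that: "c \<ge> 0"
  shows "(\<Sum>i. ennreal (if real i \<le> x then c else 0)) \<le> ennreal ((x + 1) * c)"
proof -
  have "(\<Sum>i. ennreal (if real i \<le> x then c else 0)) = (\<Sum>i\<le>nat \<lfloor>x\<rfloor>. ennreal (if real i \<le> x then c else 0))"
  proof (rule suminf_finite)
    fix i assume "i \<notin> {..nat \<lfloor>x\<rfloor>}"
    then have "\<not> real i \<le> x" by (auto simp: not_le) linarith
    then show "ennreal (if real i \<le> x then c else 0) = 0" by simp
  qed simp
  also have "\<dots> \<le> (\<Sum>i\<le>nat \<lfloor>x\<rfloor>. ennreal c)" using that by (intro sum_mono) auto
  also have "\<dots> = ennreal (real (Suc (nat \<lfloor>x\<rfloor>)) * c)"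
    using that by (simp add: ennreal_mult ennreal_of_nat_eq_real_of_nat del: of_nat_Suc)
  also have "\<dots> \<le> ennreal ((x + 1) * c)"
    using assms that by (intro ennreal_leI mult_right_mono) linarith+
  finally show ?thesis .
qed

text \<open>The bound is independent of j, hence uniform in n: the sum starts where the exponent
  becomes negative, and one full geometric series dominates it.\<close>

lemma suminf_geometric_tail_le:
  assumes a: "a > 0" and j: "j \<ge> 0"
  shows "(\<Sum>i. ennreal (if j < a * real i then 2 powr (j - a * real i) else 0)) \<le> ennreal (1 / (1 - 2 powr (- a)))"
proof -
  define f where "f = (\<lambda>i. ennreal (if j < a * real i then 2 powr (j - a * real i) else 0))"
  define k where "k = Suc (nat \<lfloor>j / a\<rfloor>)"
  have k1: "j < a * real k"
  proof -
    have "j / a < real k" unfolding k_def using a j by simp linarith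
    then show ?thesis using a by (simp add: field_simps)
  qed
  have k2: "f i = 0" if "i < k" for i
  proof -
    have "real i \<le> j / a" using that a j unfolding k_def
      by (metis divide_nonneg_pos le_nat_floor less_Suc_eq_le of_nat_floor of_nat_mono order_trans)
    then show ?thesis using a by (simp add: f_def field_simps)
  qed
  have lt1: "2 powr (- a) < 1" using a by (simp add: powr_less_one)
  have "suminf f = (\<Sum>i. f (i + k)) + (\<Sum>i<k. f i)" by (rule suminf_offset) auto
  also have "\<dots> = (\<Sum>i. f (i + k))" using k2 by simp
  also have "\<dots> \<le> (\<Sum>i. ennreal ((2 powr (- a)) ^ i))"
  proof (rule suminf_le)
    fix i
    have "2 powr (j - a * real (i + k)) \<le> 2 powr (- a * real i)" using k1 by (intro powr_mono) (auto simp: algebra_simps)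
    also have "\<dots> = (2 powr (- a)) ^ i" by (simp add: powr_powr flip: powr_realpow)
    finally show "f (i + k) \<le> ennreal ((2 powr (- a)) ^ i)" by (auto simp: f_def intro!: ennreal_leI)
  qed auto
  also have "\<dots> = ennreal (1 / (1 - 2 powr (- a)))"
    using lt1 by (intro suminf_ennreal_eq geometric_sums) auto
  finally show ?thesis by (simp add: f_def)
qed


text \<open>With j = log2 n the scales fall into three ranges. Up to j/a the mass is bounded by 1
  (\<open>t1\<close>), which gives the main term. From j/a to 3j it is at most \<delta> for the
  exceptional u (\<open>t2\<close>) plus a geometric tail (\<open>t3\<close>). Past 3j the bound by
  a third of the digits leaves another geometric tail (\<open>t4\<close>).\<close>

lemma digit_law_spread:
  assumes \<epsilon>: "\<epsilon> > 0"
  shows "\<forall>\<^sub>F n in sequentially. \<forall>A. finite A \<and> A \<noteq> {} \<and> card A \<le> n \<longrightarrow>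
     (\<integral>\<^sup>+y. neglog (infdist y A) \<partial>digit_law) \<le> ennreal ((1 + \<epsilon>) * ln (real n))"
proof -
  \<comment> \<open>The terms linear in j add up to j/a + 3 \<delta> j = (1 + 4 \<delta>) j = (1 +
    \<epsilon>/2) j; the other \<epsilon>/2 absorbs the constant K.\<close>
  define \<delta> where "\<delta> = \<epsilon> / 8"
  define a where "a = 1 / (1 + \<delta>)"
  have \<delta>: "\<delta> > 0" using \<epsilon> by (simp add: \<delta>_def)
  have a: "0 < a" "a < 1" "1 / a = 1 + \<delta>" using \<delta> by (auto simp: a_def field_simps)
  \<comment> \<open>Everything that does not grow with n: the rounding terms of the two counts and
    the two geometric series, each with the factor 4 from the four cells per point.\<close>
  define K where "K = 1 + \<delta> + 4 / (1 - 2 powr (- a)) + 4 / (1 - 2 powr (- (1/3)))"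
  have Kpos: "1 / (1 - 2 powr (- a)) \<ge> 0" "1 / (1 - 2 powr (- (1/3::real))) \<ge> 0"
    using powr_less_one[of "2::real" "- a"] powr_less_one[of "2::real" "- (1/3)"] a by auto
  obtain i0 where i0: "\<And>i. i \<ge> i0 \<Longrightarrow> emeasure unif {u. real (card ({..<i} \<inter> zero_digits u)) > (1 - a) * real i} \<le> ennreal \<delta>"
    using many_zero_digits_small[of "1 - a" \<delta>] a \<delta> by (auto simp: eventually_sequentially)
  have "\<forall>\<^sub>F n in sequentially. ln (real n) > max (max 0 (ln 2 * i0)) (K * ln 2 / (\<epsilon> / 2))"
    using filterlim_compose[OF ln_at_top filterlim_real_sequentially]
    unfolding filterlim_at_top_dense by blast
  then show ?thesis
  proof eventually_elim
    case (elim n)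
    define j where "j = log 2 (real n)"
    have n0: "real n > 0" using elim by (cases "n = 0") (auto simp: mult_less_0_iff)
    have jl: "ln 2 * j = ln n" by (simp add: j_def log_def)
    \<comment> \<open>The threshold for \<open>ln n\<close> ensures that every scale past j is also
      past i0, where the exceptional set of u is small.\<close>
    have j: "j > 0" "j > i0"
    proof -
      have "ln 2 * j > ln 2 * i0" "ln 2 * j > 0" using elim unfolding jl by (simp_all only: max_less_iff_conj)
      then show "j > i0" "j > 0" by (auto simp: zero_less_mult_iff)
    qed
    have nj: "real n = 2 powr j" using n0 by (simp add: j_def)
    show ?case
    proof (intro allI impI)
      fix A :: "real set" assume "finite A \<and> A \<noteq> {} \<and> card A \<le> n"
      then have A: "finite A" "A \<noteq> {}" "card A \<le> n" by auto
      define p where "p = (\<lambda>i. emeasure digit_law {y. infdist y A \<le> (1/2) ^ i})"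
      define t1 where "t1 = (\<lambda>i::nat. ennreal (if real i \<le> j / a then 1 else 0))"
      define t2 where "t2 = (\<lambda>i::nat. ennreal (if real i \<le> 3 * j then \<delta> else 0))"
      define t3 where "t3 = (\<lambda>i::nat. ennreal (if j < a * real i then 2 powr (j - a * real i) else 0))"
      define t4 where "t4 = (\<lambda>i::nat. ennreal (if j < 1/3 * real i then 2 powr (j - 1/3 * real i) else 0))"
      have "p i \<le> t1 i + t2 i + 4 * t3 i + 4 * t4 i" for i
      proof -
        consider "real i \<le> j / a" | "j / a < real i" "real i \<le> 3 * j" | "3 * j < real i" by linarith
        then show ?thesis
        proof cases
          case 1
          have "p i \<le> 1" unfolding p_def by (rule digit_law.emeasure_le_1)
          also have "1 \<le> t1 i" using 1 by (simp add: t1_def)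
          finally show ?thesis by (simp add: add_increasing2)
        next
          case 2
          have "j \<le> j / a" using a j by (simp add: field_simps)
          then have "i0 \<le> i" using 2 j by linarith
          have ij: "j < a * real i" using 2 a by (simp add: field_simps)
          have "p i \<le> ennreal (\<delta> + 4 * real n * 2 powr (- (a * i)))"
            unfolding p_def using \<delta> by (intro emeasure_digit_law_infdist_le[OF A i0[OF \<open>i0 \<le> i\<close>]]) simp
          also have "4 * real n * 2 powr (- (a * i)) = 4 * 2 powr (j - a * i)"
            by (simp add: nj flip: powr_add)
          also have "ennreal (\<delta> + 4 * 2 powr (j - a * i)) = t2 i + 4 * t3 i"
            using 2 ij \<delta> by (simp add: t2_def t3_def ennreal_mult)
          also have "\<dots> \<le> t1 i + t2 i + 4 * t3 i + 4 * t4 i"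
            by (simp add: add_increasing2 add_increasing add_right_mono)
          finally show ?thesis .
        next
          case 3
          have "p i \<le> ennreal (4 * real n * 2 powr (- (i / 3)))"
            unfolding p_def by (rule emeasure_digit_law_infdist_le_third[OF A])
          also have "4 * real n * 2 powr (- (i / 3)) = 4 * 2 powr (j - 1/3 * real i)"
            by (simp add: nj flip: powr_add)
          also have "ennreal \<dots> = 4 * t4 i"
            using 3 by (simp add: t4_def ennreal_mult)
          also have "\<dots> \<le> t1 i + t2 i + 4 * t3 i + 4 * t4 i"
            by (simp add: add_increasing)
          finally show ?thesis .
        qed
      qed
      then have "(\<Sum>i. p i) \<le> (\<Sum>i. t1 i + t2 i + 4 * t3 i + 4 * t4 i)"
        by (intro suminf_le) auto
      also have "\<dots> = (\<Sum>i. t1 i) + (\<Sum>i. t2 i) + 4 * (\<Sum>i. t3 i) + 4 * (\<Sum>i. t4 i)"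
        by (simp add: suminf_add[symmetric])
      also have "\<dots> \<le> ennreal ((j / a + 1) * 1) + ennreal ((3 * j + 1) * \<delta>) + 4 * ennreal (1 / (1 - 2 powr (- a))) + 4 * ennreal (1 / (1 - 2 powr (- (1/3))))"
        unfolding t1_def t2_def t3_def t4_def
        using a j \<delta> by (intro add_mono mult_left_mono suminf_count_le suminf_geometric_tail_le) auto
      also have "\<dots> = ennreal ((j / a + 1) + (3 * j + 1) * \<delta> + 4 * (1 / (1 - 2 powr (- a))) + 4 * (1 / (1 - 2 powr (- (1/3)))))"
        using a j \<delta> Kpos by (simp add: ennreal_mult ennreal_plus del: times_divide_eq_right)
      also have "(j / a + 1) + (3 * j + 1) * \<delta> + 4 * (1 / (1 - 2 powr (- a))) + 4 * (1 / (1 - 2 powr (- (1/3)))) = (1 + \<epsilon> / 2) * j + K"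
      proof -
        have "j / a = (1 + \<delta>) * j" using a by (metis mult.commute times_divide_eq_right mult.right_neutral)
        then have "(j / a + 1) + (3 * j + 1) * \<delta> = (1 + \<epsilon> / 2) * j + (1 + \<delta>)"
          by (simp add: \<delta>_def field_simps)
        then show ?thesis by (simp add: K_def)
      qed
      finally have sum_p: "(\<Sum>i. p i) \<le> ennreal ((1 + \<epsilon> / 2) * j + K)" .
      have "(\<integral>\<^sup>+y. neglog (infdist y A) \<partial>digit_law)
          \<le> (\<integral>\<^sup>+y. ennreal (ln 2) * (\<Sum>i. indicator {y. infdist y A \<le> (1/2) ^ i} y) \<partial>digit_law)"
        using neglog_le_sum[OF infdist_nonneg[of _ A]] by (intro nn_integral_mono) (simp add: indicator_def)
      also have "\<dots> = ennreal (ln 2) * (\<Sum>i. p i)"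
        by (simp add: nn_integral_cmult nn_integral_suminf p_def)
      also have "\<dots> \<le> ennreal (ln 2) * ennreal ((1 + \<epsilon> / 2) * j + K)"
        by (intro mult_left_mono sum_p) auto
      also have "\<dots> = ennreal (ln 2 * ((1 + \<epsilon> / 2) * j + K))"
        using Kpos \<epsilon> j \<delta> by (subst ennreal_mult) (auto simp: K_def)
      also have "\<dots> \<le> ennreal ((1 + \<epsilon>) * ln (real n))"
      proof (rule ennreal_leI)
        have "K * ln 2 / (\<epsilon> / 2) < ln n" using elim by simp
        then have "K * ln 2 \<le> \<epsilon> / 2 * ln n" using \<epsilon> by (simp add: field_simps)
        then have "(1 + \<epsilon> / 2) * (ln 2 * j) + K * ln 2 \<le> (1 + \<epsilon>) * ln n" unfolding jl by (simp add: algebra_simps)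
        then show "ln 2 * ((1 + \<epsilon> / 2) * j + K) \<le> (1 + \<epsilon>) * ln (real n)" by (simp add: algebra_simps)
      qed
      finally show "(\<integral>\<^sup>+y. neglog (infdist y A) \<partial>digit_law) \<le> ennreal ((1 + \<epsilon>) * ln (real n))" .
    qed
  qed
qed

section \<open>The limsup set of numbers with long runs of zeros\<close>

definition zero_block_cell :: "nat \<Rightarrow> nat \<Rightarrow> real set" where
  "zero_block_cell c q = {real q / 2 ^ 4 ^ c .. real q / 2 ^ 4 ^ c + 1 / 2 ^ (2 * 4 ^ c)}"

definition zero_block_limsup :: "real set" where
  "zero_block_limsup = (\<Inter>m. \<Union>c\<in>{m..}. \<Union>q<2 ^ 4 ^ c. zero_block_cell c q)"

lemma zero_block_limsup_borel [measurable]: "zero_block_limsup \<in> sets borel"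
  unfolding zero_block_limsup_def zero_block_cell_def by measurable

text \<open>For u \<ge> 1 generation m zeroes the block with index
  \<open>nat \<lfloor>2 ^ m * u\<rfloor> \<ge> m\<close>, so zeroed blocks of arbitrarily large
  index occur.\<close>

lemma AE_digit_law_limsup: "AE y in digit_law. y \<in> zero_block_limsup"
proof -
  have "AE x in unif \<Otimes>\<^sub>M coins. (\<lambda>(u, b). digit_value (\<lambda>l. b l \<and> l \<notin> zero_digits u)) x \<in> zero_block_limsup"
  proof -
    have "AE x in unif \<Otimes>\<^sub>M coins. 1 \<le> fst x"
    proof (rule unif_coins.AE_pair_measure)
      show "{x \<in> space (unif \<Otimes>\<^sub>M coins). 1 \<le> fst x} \<in> sets (unif \<Otimes>\<^sub>M coins)" by measurable
    qed (use AE_unif in auto)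
    then show ?thesis
    proof eventually_elim
      case (elim x)
      obtain u b where x: "x = (u, b)" by force
      with elim have u: "1 \<le> u" by simp
      let ?D = "\<lambda>l. b l \<and> l \<notin> zero_digits u"
      have "\<exists>c\<ge>m. \<exists>q<2 ^ 4 ^ c. digit_value ?D \<in> zero_block_cell c q" for m
      proof -
        define c where "c = nat \<lfloor>2 ^ m * u\<rfloor>"
        have "real m \<le> 2 ^ m" using of_nat_less_two_power[of m, where 'a=real] by simp
        also have "\<dots> \<le> 2 ^ m * u" using u by simp
        finally have "m \<le> c" unfolding c_def by (simp add: le_nat_floor)
        moreover have "\<not> ?D l" if "4 ^ c \<le> l" "l < 2 * 4 ^ c" for l
          using that by (auto simp: zero_digits_def c_def)
        then have "digit_value ?D \<in> zero_block_cell c (digit_prefix ?D (4 ^ c))"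
          unfolding zero_block_cell_def using digit_value_ge digit_value_le[of "4 ^ c" "2 * 4 ^ c" ?D] by auto
        ultimately show ?thesis using digit_prefix_less by blast
      qed
      then show ?case unfolding x zero_block_limsup_def by fastforce
    qed
  qed
  then show ?thesis
    unfolding digit_law_def by (subst AE_distr_iff) auto
qed

text \<open>With J = 4^c there are 2^J cells of diameter 2^(-2J); at exponent 3/4 they contribute
  2^(-J/2), which \<open>2 * c \<le> 4 ^ c\<close> bounds by 2^-c. The tails of this geometric
  series vanish.\<close>

lemma hausdorff_measure_limsup: "hausdorff_measure (3/4) zero_block_limsup = 0"
proof (rule hausdorff_measure_eq_0I)
  fix \<delta> \<eta> :: real assume pos: "\<delta> > 0" "\<eta> > 0"
  \<comment> \<open>Covering starts at block K: the diameters are then at most 2^-K < \<delta>, and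
    the covering sum at most 2 * 2^-K < \<eta>.\<close>
  obtain K where K: "(1/2) ^ K < min \<delta> (\<eta> / 2)"
    using real_arch_pow_inv[of "min \<delta> (\<eta> / 2)" "1/2"] pos by auto
  define V where "V = (\<lambda>k q. if q < 2 ^ 4 ^ (k + K) then zero_block_cell (k + K) q else {})"
  have diam: "diameter (zero_block_cell c q) = 1 / 2 ^ (2 * 4 ^ c)" for c q
    unfolding zero_block_cell_def by (subst diameter_closed_interval) auto
  have "Suc (2 * c) \<le> 4 ^ c" for c :: nat by (induction c) auto
  then have c4: "2 * c \<le> 4 ^ c" for c :: nat using Suc_leD by blast
  have half: "2 powr (- real m) = (1/2::real) ^ m" for m
    by (simp add: powr_minus powr_realpow power_one_over inverse_eq_divide)
  have small: "1 / 2 ^ (2 * 4 ^ (k + K)) \<le> \<delta>" for k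
  proof -
    have "(1/2::real) ^ (2 * 4 ^ (k + K)) \<le> (1/2) ^ K"
      using c4[of "k + K"] by (intro power_decreasing) auto
    then show ?thesis using K by (simp add: power_one_over)
  qed
  have cov: "zero_block_limsup \<subseteq> (\<Union>k q. V k q)"
  proof
    fix y assume "y \<in> zero_block_limsup"
    then obtain c q where "c \<ge> K" "q < 2 ^ 4 ^ c" "y \<in> zero_block_cell c q"
      unfolding zero_block_limsup_def by blast
    then have "y \<in> V (c - K) q" by (simp add: V_def)
    then show "y \<in> (\<Union>k q. V k q)" by blast
  qed
  have "(\<Sum>q. ennreal (diameter (V k q) powr (3/4))) \<le> ennreal ((1/2) ^ (k + K))" for k
  proof -
    define J :: nat where "J = 4 ^ (k + K)"
    have "(\<Sum>q. ennreal (diameter (V k q) powr (3/4))) = (\<Sum>q<2 ^ J. ennreal (diameter (V k q) powr (3/4)))"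
      by (rule suminf_finite) (auto simp: V_def J_def)
    also have "\<dots> = (\<Sum>q<(2::nat) ^ J. ennreal ((1 / 2 ^ (2 * J)) powr (3/4)))"
      by (intro sum.cong) (auto simp: V_def diam J_def)
    also have "\<dots> = ennreal (2 ^ J * (1 / 2 ^ (2 * J)) powr (3/4))"
      by (simp add: ennreal_mult ennreal_of_nat_eq_real_of_nat)
    also have "2 ^ J * (1 / 2 ^ (2 * J)) powr (3/4) = (2::real) powr (- (J / 2))"
    proof -
      have "1 / 2 ^ (2 * J) = (2::real) powr (- (2 * real J))"
        by (subst powr_minus) (simp add: powr_realpow[symmetric] divide_inverse)
      then have "(1 / 2 ^ (2 * J)) powr (3/4) = (2::real) powr (- (2 * real J) * (3/4))"
        by (simp add: powr_powr)
      moreover have "(2::real) ^ J = 2 powr (real J)" by (simp add: powr_realpow)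
      ultimately show ?thesis by (simp flip: powr_add)
    qed
    also have "ennreal (2 powr (- (J / 2))) \<le> ennreal (2 powr (- real (k + K)))"
    proof (intro ennreal_leI powr_mono)
      have "real (2 * (k + K)) \<le> real J" unfolding J_def using c4[of "k + K"] of_nat_mono by blast
      then show "- (J / 2) \<le> - real (k + K)" by simp
    qed simp
    also have "2 powr (- real (k + K)) = (1/2::real) ^ (k + K)"
      by (rule half)
    finally show ?thesis .
  qed
  then have "(\<Sum>k. \<Sum>q. ennreal (diameter (V k q) powr (3/4))) \<le> (\<Sum>k. ennreal ((1/2) ^ (k + K)))"
    by (intro suminf_le) auto
  also have "\<dots> = ennreal (2 * (1/2) ^ K)"
    using sums_mult2[OF geometric_sums[of "1/2::real"], of "(1/2) ^ K"]
    by (intro suminf_ennreal_eq) (auto simp: power_add)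
  also have "\<dots> \<le> ennreal \<eta>" using K by (intro ennreal_leI) auto
  finally have "(\<Sum>k. \<Sum>q. ennreal (diameter (V k q) powr (3/4))) \<le> ennreal \<eta>" .
  moreover have "bounded (V k q) \<and> diameter (V k q) \<le> \<delta>" for k q
    using small[of k] pos by (auto simp: V_def diam) (auto simp: zero_block_cell_def)
  ultimately show "\<exists>V :: nat \<Rightarrow> nat \<Rightarrow> real set. zero_block_limsup \<subseteq> (\<Union>k q. V k q) \<and>
      (\<forall>k q. bounded (V k q) \<and> diameter (V k q) \<le> \<delta>) \<and>
      (\<Sum>k. \<Sum>q. ennreal (diameter (V k q) powr (3/4))) \<le> ennreal \<eta>"
    using cov by blast
qed

subsection \<open>Approximation\<close>

text \<open>Here the finite first moment is used: simple functions converge to the identity with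
  norm at most twice \<open>norm x\<close>, so \<open>3 * norm x\<close> dominates the
  differences.\<close>

lemma simple_function_approx_id:
  fixes \<mu> :: "'a::euclidean_space measure"
  assumes \<mu>: "\<mu> \<in> Omega" and \<epsilon>: "\<epsilon> > 0"
  obtains f :: "'a \<Rightarrow> 'a" where "f \<in> borel_measurable borel" "finite (range f)"
    "(\<integral>x. norm (x - f x) \<partial>\<mu>) < \<epsilon>"
proof -
  have sets: "sets \<mu> = sets borel" and int: "integrable \<mu> (\<lambda>x. norm x)" using \<mu> by (auto simp: Omega_def)
  note [measurable_cong] = sets
  have space: "space \<mu> = UNIV" using sets_eq_imp_space_eq[OF sets] by simp
  have "(\<lambda>x::'a. x) \<in> borel_measurable \<mu>" by measurable
  from borel_measurable_implies_sequence_metric[OF this, of 0]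
  obtain F where F: "\<And>i. simple_function \<mu> (F i)" "\<And>x. (\<lambda>i. F i x) \<longlonglongrightarrow> x" "\<And>i x. norm (F i x) \<le> 2 * norm x"
    by (auto simp: space)
  have Fm[measurable]: "F i \<in> borel_measurable \<mu>" for i by (rule borel_measurable_simple_function[OF F(1)])
  have "(\<lambda>i. \<integral>x. norm (x - F i x) \<partial>\<mu>) \<longlonglongrightarrow> (\<integral>x. 0 \<partial>\<mu>)"
  proof (rule integral_dominated_convergence[where w="\<lambda>x. 3 * norm x"])
    show "AE x in \<mu>. norm (norm (x - F i x)) \<le> 3 * norm x" for i
    proof (rule AE_I2)
      fix x show "norm (norm (x - F i x)) \<le> 3 * norm x"
        using norm_triangle_ineq4[of x "F i x"] F(3)[of i x] by simp
    qed
    show "AE x in \<mu>. (\<lambda>i. norm (x - F i x)) \<longlonglongrightarrow> 0"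
    proof (rule AE_I2)
      fix x show "(\<lambda>i. norm (x - F i x)) \<longlonglongrightarrow> 0"
        using tendsto_norm[OF tendsto_diff[OF tendsto_const F(2), of x x]] by simp
    qed
  qed (use int in auto)
  then have "(\<lambda>i. \<integral>x. norm (x - F i x) \<partial>\<mu>) \<longlonglongrightarrow> 0" by simp
  then have "\<forall>\<^sub>F i in sequentially. (\<integral>x. norm (x - F i x) \<partial>\<mu>) < \<epsilon>" by (rule order_tendstoD(2)[OF _ \<epsilon>])
  then obtain i where i: "(\<integral>x. norm (x - F i x) \<partial>\<mu>) < \<epsilon>" by (auto dest: eventually_happens)
  show ?thesis
  proof (rule that[of "F i"])
    show "F i \<in> borel_measurable borel" using Fm[of i] measurable_cong_sets[OF sets refl] by blast
    show "finite (range (F i))" using simple_functionD(1)[OF F(1)[of i]] by (simp add: space)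
  qed (rule i)
qed

text \<open>The easy half of Kantorovich duality: S and T on the common space Q couple the two laws,
  and the cost of this coupling bounds their distance.\<close>

lemma dL_distr_le:
  fixes S T :: "'b \<Rightarrow> 'a::euclidean_space"
  assumes "prob_space Q" and [measurable]: "S \<in> borel_measurable Q" "T \<in> borel_measurable Q"
    and S: "integrable Q (\<lambda>x. norm (S x))" and T: "integrable Q (\<lambda>x. norm (T x))"
  shows "dL (distr Q borel S) (distr Q borel T) \<le> (\<integral>x. norm (S x - T x) \<partial>Q)"
  unfolding dL_def
proof (rule cSUP_least)
  interpret prob_space Q by fact
  have "(\<lambda>x::'a. 0::real) \<in> {h. 1-lipschitz_on UNIV h}" by (auto intro: lipschitz_onI)
  then show "{h::'a \<Rightarrow> real. 1-lipschitz_on UNIV h} \<noteq> {}" by blast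
  fix h :: "'a \<Rightarrow> real" assume "h \<in> {h. 1-lipschitz_on UNIV h}"
  then have h: "1-lipschitz_on UNIV h" by simp
  have [measurable]: "h \<in> borel_measurable borel"
    by (intro borel_measurable_continuous_onI lipschitz_on_continuous_on[OF h])
  have hd: "\<bar>h x - h y\<bar> \<le> norm (x - y)" for x y
    using lipschitz_onD[OF h, of x y] by (simp add: dist_norm dist_real_def)
  have int: "integrable Q (\<lambda>x. h (R x))" if [measurable]: "R \<in> borel_measurable Q" and R: "integrable Q (\<lambda>x. norm (R x))" for R
  proof (rule Bochner_Integration.integrable_bound[of Q "\<lambda>x. \<bar>h 0\<bar> + norm (R x)"])
    show "AE x in Q. norm (h (R x)) \<le> norm (\<bar>h 0\<bar> + norm (R x))"
    proof (rule AE_I2)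
      fix x show "norm (h (R x)) \<le> norm (\<bar>h 0\<bar> + norm (R x))" using hd[of "R x" 0] by simp
    qed
  qed (use R in auto)
  have nint: "integrable Q (\<lambda>x. norm (S x - T x))"
  proof (rule Bochner_Integration.integrable_bound[of Q "\<lambda>x. norm (S x) + norm (T x)"])
    show "AE x in Q. norm (norm (S x - T x)) \<le> norm (norm (S x) + norm (T x))"
      by (rule AE_I2) (simp add: norm_triangle_ineq4)
  qed (use S T in auto)
  have "integral\<^sup>L (distr Q borel S) h - integral\<^sup>L (distr Q borel T) h = (\<integral>x. h (S x) - h (T x) \<partial>Q)"
    by (simp add: integral_distr int S T)
  also have "\<bar>\<dots>\<bar> \<le> (\<integral>x. \<bar>h (S x) - h (T x)\<bar> \<partial>Q)"
    using integral_norm_bound[of Q "\<lambda>x. h (S x) - h (T x)"] by simp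
  also have "\<dots> \<le> (\<integral>x. norm (S x - T x) \<partial>Q)"
    by (rule integral_mono) (use int S T nint hd in auto)
  finally show "\<bar>integral\<^sup>L (distr Q borel S) h - integral\<^sup>L (distr Q borel T) h\<bar> \<le> (\<integral>x. norm (S x - T x) \<partial>Q)" .
qed

lemma Omega_distrI:
  assumes "prob_space Q" "T \<in> borel_measurable Q" "\<And>x. x \<in> space Q \<Longrightarrow> norm (T x) \<le> K"
  shows "distr Q borel T \<in> Omega" "integrable Q (\<lambda>x. norm (T x))"
proof -
  interpret prob_space Q by fact
  note [measurable] = assms(2)
  show *: "integrable Q (\<lambda>x. norm (T x))"
    by (rule integrable_const_bound[of _ K]) (use assms in auto)
  show "distr Q borel T \<in> Omega"
    unfolding Omega_def using * by (auto intro: prob_space_distr simp: integrable_distr_eq)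
qed

lemma distr_finite_range_Omega0:
  fixes \<mu> :: "'a::euclidean_space measure" and f :: "'a \<Rightarrow> 'a"
  assumes \<mu>: "\<mu> \<in> Omega" and [measurable]: "f \<in> borel_measurable borel" and fin: "finite (range f)"
  shows "distr \<mu> borel f \<in> Omega0"
proof -
  interpret prob_space \<mu> using \<mu> by (simp add: Omega_def)
  have sets: "sets \<mu> = sets borel" using \<mu> by (simp add: Omega_def)
  note [measurable_cong] = sets
  define \<nu> where "\<nu> = distr \<mu> borel f"
  have [measurable]: "f \<in> borel_measurable \<mu>" by measurable
  interpret \<nu>: prob_space \<nu> unfolding \<nu>_def by (rule prob_space_distr) simp
  obtain K where K: "\<And>x. norm (f x) \<le> K"
    using finite_imp_bounded[OF fin] unfolding bounded_iff by auto
  have Om: "\<nu> \<in> Omega" unfolding \<nu>_def by (rule Omega_distrI(1)[OF prob_space_axioms]) (use K in auto)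
  have AE0: "AE x in \<nu>. infdist x (range f) = 0"
    unfolding \<nu>_def by (subst AE_distr_iff) auto
  have V0: "Vq n r \<nu> = 0" if "n \<ge> card (range f)" "r > 0" for n r
  proof -
    have "Vq n r \<nu> \<le> (\<integral>\<^sup>+x. ennreal (infdist x (range f) powr r) \<partial>\<nu>)"
      unfolding Vq_def by (intro INF_lower) (use that fin in auto)
    also have "\<dots> = (\<integral>\<^sup>+x. 0 \<partial>\<nu>)"
      by (rule nn_integral_cong_AE) (use AE0 in \<open>eventually_elim, simp\<close>)
    finally show ?thesis by simp
  qed
  have L0: "log_en n \<nu> = - \<infinity>" if "n \<ge> card (range f)" for n
  proof -
    have "(\<integral>\<^sup>+x. neglog (infdist x (range f)) \<partial>\<nu>) = (\<integral>\<^sup>+x. \<infinity> \<partial>\<nu>)"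
      by (rule nn_integral_cong_AE) (use AE0 in \<open>eventually_elim, simp add: neglog_def\<close>)
    also have "\<dots> = \<infinity>" by (simp add: \<nu>.emeasure_space_1)
    \<comment> \<open>The positive part is a real number by \<open>enn2real\<close>, so subtracting
      infinity from it does give minus infinity.\<close>
    finally have "log_int \<nu> (range f) = - \<infinity>"
      unfolding log_int_def neglog_def[symmetric] by simp
    moreover have "log_en n \<nu> \<le> log_int \<nu> (range f)"
      unfolding log_en_def by (intro INF_lower) (use that fin in auto)
    ultimately show ?thesis by simp
  qed
  have DR: "has_Dr r \<nu> 0" if "r > 0" for r
  proof -
    have "\<forall>\<^sub>F n in sequentially. Vq n r \<nu> = 0"
      using eventually_ge_at_top[of "card (range f)"] by eventually_elim (use V0 that in auto)
    then show ?thesis unfolding has_Dr_def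
      by (auto intro!: tendsto_eventually elim!: eventually_mono simp: Dr_term_def)
  qed
  have D0: "has_D0 \<nu> 0"
  proof -
    have "\<forall>\<^sub>F n in sequentially. log_en n \<nu> = - \<infinity>"
      using eventually_ge_at_top[of "card (range f)"] by eventually_elim (use L0 in auto)
    then show ?thesis unfolding has_D0_def
      by (auto intro!: tendsto_eventually elim!: eventually_mono simp: D0_term_def)
  qed
  have dims: "\<forall>\<^sub>F r in at_right 0. \<exists>d. has_Dr r \<nu> d" "\<exists>d. has_D0 \<nu> d" "D0 \<nu> = 0"
    "((\<lambda>r. Dr r \<nu>) \<longlongrightarrow> D0 \<nu>) (at_right 0)"
    using quantization_dims_tendsto[of \<nu> 0] DR D0 by blast+
  have "emeasure \<nu> (range f) = 1"
  proof -
    have "range f \<in> sets borel" using fin by (simp add: finite_imp_closed)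
    then have "emeasure \<nu> (range f) = emeasure \<mu> (f -` range f \<inter> space \<mu>)"
      unfolding \<nu>_def by (intro emeasure_distr) auto
    also have "f -` range f \<inter> space \<mu> = space \<mu>" by auto
    finally show ?thesis by (simp add: emeasure_space_1)
  qed
  then have "hausdorff_dim_measure \<nu> \<le> 0"
    using fin by (intro hausdorff_dim_measure_le[of "range f"] hausdorff_measure_finite_null) (auto simp: finite_imp_closed)
  moreover have "hausdorff_dim_measure \<nu> \<ge> 0"
    using \<nu>.emeasure_space_1 by (intro hausdorff_dim_measure_nonneg) (simp add: \<nu>_def)
  ultimately show ?thesis
    using Om dims unfolding Omega0_def \<nu>_def by auto
qed

text \<open>Segments over different points of the range may overlap, so the logarithmic integral is
  estimated for each fixed x, where projection to the line through f x reduces it to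
  \<open>digit_law\<close>. Clamping y to [0, 1] keeps the map bounded at every point and changes
  nothing almost surely.\<close>

lemma distr_digit_law_Omega0_gt:
  fixes \<mu> :: "'a::euclidean_space measure" and f :: "'a \<Rightarrow> 'a"
  assumes \<mu>: "\<mu> \<in> Omega" and [measurable]: "f \<in> borel_measurable borel" and fin: "finite (range f)"
    and e: "norm e = 1" and c: "0 < c" "c \<le> 1"
  shows "distr (\<mu> \<Otimes>\<^sub>M digit_law) borel (\<lambda>(x, y). f x + (c * max 0 (min 1 y)) *\<^sub>R e) \<in> Omega0_gt"
proof -
  interpret prob_space \<mu> using \<mu> by (simp add: Omega_def)
  have sets[measurable_cong]: "sets \<mu> = sets borel" using \<mu> by (simp add: Omega_def)
  interpret P: pair_prob_space \<mu> digit_law ..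
  define T where "T = (\<lambda>(x, y). f x + (c * max 0 (min 1 y)) *\<^sub>R e)"
  have T[measurable]: "T \<in> borel_measurable (\<mu> \<Otimes>\<^sub>M digit_law)" unfolding T_def by measurable
  define \<nu> where "\<nu> = distr (\<mu> \<Otimes>\<^sub>M digit_law) borel T"
  have ee: "e \<bullet> e = 1" using e by (simp add: norm_eq_1)
  obtain K where K: "\<And>x. norm (f x) \<le> K"
    using finite_imp_bounded[OF fin] unfolding bounded_iff by auto
  have TK: "norm (T z) \<le> K + 1" for z
  proof -
    obtain x y where z: "z = (x, y)" by force
    have "norm (T z) \<le> norm (f x) + norm ((c * max 0 (min 1 y)) *\<^sub>R e)"
        unfolding z T_def prod.case by (rule norm_triangle_ineq)
    also have "norm ((c * max 0 (min 1 y)) *\<^sub>R e) \<le> 1" using e c by (auto simp: abs_mult mult_le_one)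
    finally show ?thesis using K[of x] by linarith
  qed
  have Om: "\<nu> \<in> Omega" unfolding \<nu>_def by (rule Omega_distrI(1)[OF P.prob_space_axioms]) (use TK in auto)
  define N where "N = card (range f)"
  have N: "N > 0" using fin by (simp add: N_def card_gt_0_iff)
  \<comment> \<open>The n points are shared among N segments. The factor 2 pays for rounding n/N
    down to an integer.\<close>
  interpret Q: one_dimensional_quantization \<nu> "2 * real N"
  proof (rule one_dimensional_quantization.intro)
    show "sets \<nu> = sets borel" by (simp add: \<nu>_def)
    show "prob_space \<nu>" using Om by (simp add: Omega_def)
    show "0 < 2 * real N" using N by simp
    show "\<forall>\<^sub>F n in sequentially. \<exists>A. finite A \<and> A \<noteq> {} \<and> card A \<le> n \<and> (AE x in \<nu>. infdist x A \<le> 2 * real N / real n)"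
      using eventually_ge_at_top[of N]
    proof eventually_elim
      case (elim n)
      \<comment> \<open>Each segment gets m points; n < (m + 1) N \<le> 2 m N turns their spacing of
        at most 1/m into at most 2N/n.\<close>
      define m where "m = n div N"
      have m: "m > 0" using elim N by (simp add: m_def div_greater_zero_iff)
      have mn: "m * N \<le> n" by (simp add: m_def)
      have "n < m * N + N" using dividend_less_div_times[OF N, of n] by (simp add: m_def add.commute)
      also have "\<dots> \<le> 2 * N * m" using m by (cases m) auto
      finally have m2: "real n \<le> 2 * real N * real m" by (metis less_imp_le of_nat_le_iff of_nat_mult of_nat_numeral)
      define A where "A = (\<lambda>(p, k). p + (c * (real k / real m)) *\<^sub>R e) ` (range f \<times> {..<m})"
      have "finite A" unfolding A_def using fin by auto
      moreover have "A \<noteq> {}" unfolding A_def using m by auto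
      moreover have "card A \<le> n"
        unfolding A_def using card_image_le[of "range f \<times> {..<m}" "\<lambda>(p, k). p + (c * (real k / real m)) *\<^sub>R e"] fin mn
        by (simp add: card_cartesian_product N_def mult.commute)
      moreover have "infdist (T z) A \<le> 2 * real N / real n" for z
      proof -
        obtain x y0 where z: "z = (x, y0)" by force
        define y where "y = max 0 (min 1 y0)"
        have y: "0 \<le> y" "y \<le> 1" by (auto simp: y_def)
        have "\<exists>k<m. \<bar>y - real k / real m\<bar> \<le> 1 / real m"
        proof (cases "y = 1")
          \<comment> \<open>At the right end the floor would be m, outside the grid; the last grid
            point m - 1 is still within 1/m.\<close>
          case True
          then show ?thesis using m by (intro exI[of _ "m - 1"]) (auto simp: field_simps of_nat_diff)
        next
          case False
          define k where "k = nat \<lfloor>y * m\<rfloor>"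
          have "y * m < m" using y False m by simp
          then have "k < m" unfolding k_def using y by (simp add: nat_less_iff floor_less_iff)
          moreover have "real k \<le> y * m" "y * m \<le> real k + 1"
            unfolding k_def using y m by (simp_all add: of_nat_floor)
          then have "real k / m \<le> y" "y \<le> (real k + 1) / m" using m by (simp_all add: pos_le_divide_eq pos_divide_le_eq)
          then have "\<bar>y - real k / real m\<bar> \<le> 1 / real m" by (simp add: abs_le_iff add_divide_distrib)
          ultimately show ?thesis by blast
        qed
        then obtain k where k: "k < m" "\<bar>y - real k / real m\<bar> \<le> 1 / real m" by blast
        have "infdist (T z) A \<le> dist (T z) (f x + (c * (real k / real m)) *\<^sub>R e)"
          by (rule infdist_le) (use k in \<open>auto simp: A_def\<close>)
        also have "\<dots> = norm ((c * (y - real k / real m)) *\<^sub>R e)"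
          unfolding z T_def y_def by (simp add: dist_norm algebra_simps)
        also have "\<dots> = c * \<bar>y - real k / real m\<bar>" using e c by (simp add: abs_mult)
        also have "\<dots> \<le> 1 * (1 / real m)" using c k by (intro mult_mono) auto
        also have "\<dots> \<le> 2 * real N / real n" using m2 m elim N by (simp add: field_simps)
        finally show ?thesis .
      qed
      then have "AE x in \<nu>. infdist x A \<le> 2 * real N / real n"
        unfolding \<nu>_def by (subst AE_distr_iff) auto
      ultimately show ?case by blast
    qed
    fix \<delta> :: real assume \<delta>: "\<delta> > 0"
    have "\<forall>\<^sub>F n in sequentially. ln (real n) > - ln c / (\<delta> / 2)"
      using filterlim_compose[OF ln_at_top filterlim_real_sequentially]
      unfolding filterlim_at_top_dense by blast
    moreover have "\<forall>\<^sub>F n in sequentially. \<forall>A. finite A \<and> A \<noteq> {} \<and> card A \<le> n \<longrightarrow>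
       (\<integral>\<^sup>+y. neglog (infdist y A) \<partial>digit_law) \<le> ennreal ((1 + \<delta> / 2) * ln (real n))"
      by (rule digit_law_spread) (use \<delta> in simp)
    ultimately show "\<forall>\<^sub>F n in sequentially. \<forall>A. finite A \<and> A \<noteq> {} \<and> card A \<le> n \<longrightarrow>
        (\<integral>\<^sup>+x. neglog (infdist x A) \<partial>\<nu>) \<le> ennreal ((1 + \<delta>) * ln (real n))"
    proof eventually_elim
      case (elim n)
      have lnc: "- ln c \<ge> 0" using c by simp
      have lnn: "ln (real n) \<ge> 0" by (cases "n = 0") auto
      show ?case
      proof (intro allI impI)
        fix A :: "'a set" assume A: "finite A \<and> A \<noteq> {} \<and> card A \<le> n"
        have inner: "(\<integral>\<^sup>+y. neglog (infdist (T (x, y)) A) \<partial>digit_law) \<le> ennreal ((1 + \<delta>) * ln (real n))" for x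
        proof -
          \<comment> \<open>The orthogonal projection of A to the line through f x in direction e,
            in the coordinate y of the segment. Projecting does not increase distances, and the
            coordinate contributes the factor c.\<close>
          define A' where "A' = (\<lambda>a. ((a - f x) \<bullet> e) / c) ` A"
          have A': "finite A' \<and> A' \<noteq> {} \<and> card A' \<le> n"
            using A card_image_le[of A "\<lambda>a. ((a - f x) \<bullet> e) / c"] unfolding A'_def by auto
          have dom: "c * infdist y A' \<le> infdist (T (x, y)) A" if y: "0 \<le> y \<and> y \<le> 1" for y
          proof -
            obtain a where a: "a \<in> A" "infdist (T (x, y)) A = dist (T (x, y)) a"
              using infdist_attains_inf[of A "T (x, y)"] A finite_imp_closed by blast
            have Txy: "T (x, y) = f x + (c * y) *\<^sub>R e" using y by (simp add: T_def)
            have "infdist y A' \<le> dist y (((a - f x) \<bullet> e) / c)" by (rule infdist_le) (use a in \<open>auto simp: A'_def\<close>)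
            then have "c * infdist y A' \<le> c * \<bar>y - ((a - f x) \<bullet> e) / c\<bar>" using c by (simp add: dist_real_def)
            also have "\<dots> = \<bar>c * (y - ((a - f x) \<bullet> e) / c)\<bar>" using c by (simp add: abs_mult)
            also have "c * (y - ((a - f x) \<bullet> e) / c) = (T (x, y) - a) \<bullet> e"
              using c by (simp add: Txy inner_diff_left inner_add_left ee field_simps)
            also have "\<bar>\<dots>\<bar> \<le> norm (T (x, y) - a) * norm e" by (rule Cauchy_Schwarz_ineq2)
            finally show ?thesis using a e by (simp add: dist_norm)
          qed
          have "AE y in digit_law. neglog (infdist (T (x, y)) A) \<le> ennreal (- ln c) + neglog (infdist y A')"
            using AE_digit_law_unit
          proof (eventually_elim)
            case (elim y)
            have "neglog (infdist (T (x, y)) A) \<le> neglog (c * infdist y A')"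
              using dom[OF elim] c by (intro neglog_antimono) (auto simp: infdist_nonneg)
            also have "\<dots> \<le> ennreal (- ln c) + neglog (infdist y A')"
              by (rule neglog_mult_le) (use c in \<open>auto simp: infdist_nonneg\<close>)
            finally show ?case .
          qed
          then have "(\<integral>\<^sup>+y. neglog (infdist (T (x, y)) A) \<partial>digit_law) \<le> (\<integral>\<^sup>+y. ennreal (- ln c) + neglog (infdist y A') \<partial>digit_law)"
            by (rule nn_integral_mono_AE)
          also have "\<dots> = ennreal (- ln c) + (\<integral>\<^sup>+y. neglog (infdist y A') \<partial>digit_law)"
            by (subst nn_integral_add) (auto simp: digit_law.emeasure_space_1)
          also have "\<dots> \<le> ennreal (- ln c) + ennreal ((1 + \<delta> / 2) * ln (real n))"
            using elim(2) A' by (intro add_left_mono) blast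
          also have "\<dots> = ennreal (- ln c + (1 + \<delta> / 2) * ln (real n))"
            using lnc lnn \<delta> by (subst ennreal_plus) auto
          also have "\<dots> \<le> ennreal ((1 + \<delta>) * ln (real n))"
          proof (rule ennreal_leI)
            have "- ln c \<le> \<delta> / 2 * ln n" using elim(1) \<delta> by (simp add: field_simps)
            then show "- ln c + (1 + \<delta> / 2) * ln (real n) \<le> (1 + \<delta>) * ln (real n)" by (simp add: algebra_simps)
          qed
          finally show ?thesis .
        qed
        have "(\<integral>\<^sup>+z. neglog (infdist z A) \<partial>\<nu>) = (\<integral>\<^sup>+z. neglog (infdist (T z) A) \<partial>(\<mu> \<Otimes>\<^sub>M digit_law))"
          unfolding \<nu>_def by (rule nn_integral_distr) auto
        also have "\<dots> = (\<integral>\<^sup>+x. \<integral>\<^sup>+y. neglog (infdist (T (x, y)) A) \<partial>digit_law \<partial>\<mu>)"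
          by (rule digit_law.nn_integral_fst[symmetric]) measurable
        also have "\<dots> \<le> (\<integral>\<^sup>+x. ennreal ((1 + \<delta>) * ln (real n)) \<partial>\<mu>)"
          by (intro nn_integral_mono inner)
        finally show "(\<integral>\<^sup>+x. neglog (infdist x A) \<partial>\<nu>) \<le> ennreal ((1 + \<delta>) * ln (real n))"
          by (simp add: emeasure_space_1)
      qed
    qed
  qed
  have dims: "\<forall>\<^sub>F r in at_right 0. \<exists>d. has_Dr r \<nu> d" "\<exists>d. has_D0 \<nu> d" "D0 \<nu> = 1"
    "((\<lambda>r. Dr r \<nu>) \<longlongrightarrow> D0 \<nu>) (at_right 0)"
    using quantization_dims_tendsto[of \<nu> 1] Q.has_Dr_1 Q.has_D0_1 by blast+
  define G where "G = (\<Union>p\<in>range f. (\<lambda>y. p + (c * y) *\<^sub>R e) ` zero_block_limsup)"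
  \<comment> \<open>The image is rewritten as a set given by conditions on z, a coordinate in the
    limsup set and membership in the line, so that it is seen to be Borel.\<close>
  have img: "(\<lambda>y. p + (c * y) *\<^sub>R e) ` zero_block_limsup
      = {z. ((z - p) \<bullet> e) / c \<in> zero_block_limsup \<and> z = p + ((z - p) \<bullet> e) *\<^sub>R e}" for p
  proof (intro set_eqI iffI)
    fix z assume "z \<in> {z. ((z - p) \<bullet> e) / c \<in> zero_block_limsup \<and> z = p + ((z - p) \<bullet> e) *\<^sub>R e}"
    then show "z \<in> (\<lambda>y. p + (c * y) *\<^sub>R e) ` zero_block_limsup"
      using c by (intro image_eqI[of _ _ "((z - p) \<bullet> e) / c"]) auto
  qed (use c ee in auto)
  have "(\<lambda>y. p + (c * y) *\<^sub>R e) ` zero_block_limsup \<in> sets borel" for p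
  proof -
    have "{z \<in> space borel. ((z - p) \<bullet> e) / c \<in> zero_block_limsup \<and> z = p + ((z - p) \<bullet> e) *\<^sub>R e} \<in> sets borel"
      by measurable
    then show ?thesis unfolding img by simp
  qed
  then have G: "G \<in> sets borel" unfolding G_def using fin by (intro sets.finite_UN) auto
  have "hausdorff_measure (3/4) G = 0"
  proof -
    have "hausdorff_measure (3/4) ((\<lambda>y. p + (c * y) *\<^sub>R e) ` zero_block_limsup) = 0" for p
    proof (rule hausdorff_measure_lipschitz_image_null[OF hausdorff_measure_limsup])
      show "c-lipschitz_on UNIV (\<lambda>y. p + (c * y) *\<^sub>R e)"
      proof (rule lipschitz_onI)
        fix y y' :: real
        have "dist (p + (c * y) *\<^sub>R e) (p + (c * y') *\<^sub>R e) = norm ((c * (y - y')) *\<^sub>R e)"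
          by (simp add: dist_norm algebra_simps)
        also have "\<dots> = c * dist y y'" using e c by (simp add: abs_mult dist_real_def)
        finally show "dist (p + (c * y) *\<^sub>R e) (p + (c * y') *\<^sub>R e) \<le> c * dist y y'" by simp
      qed (use c in auto)
    qed (use c in auto)
    \<comment> \<open>A sequence with repetitions runs through the finite range, which makes G a
      countable union.\<close>
    moreover have r: "range (from_nat_into (range f)) = range f"
      by (rule range_from_nat_into) (use fin countable_finite in auto)
    have "G = (\<Union>i. (\<lambda>y. from_nat_into (range f) i + (c * y) *\<^sub>R e) ` zero_block_limsup)"
      unfolding G_def by (subst r[symmetric]) (simp only: image_image)
    ultimately show ?thesis by (simp add: hausdorff_measure_UN_null)
  qed
  moreover have "emeasure \<nu> G = 1"
  proof -
    have in_G: "AE y in digit_law. T (x, y) \<in> G" for x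
      using AE_digit_law_limsup AE_digit_law_unit
    proof eventually_elim
      case (elim y)
      then have "T (x, y) = f x + (c * y) *\<^sub>R e" by (simp add: T_def)
      then show ?case using elim unfolding G_def by blast
    qed
    have "AE z in \<mu> \<Otimes>\<^sub>M digit_law. T z \<in> G"
    proof (rule P.AE_pair_measure)
      show "{z \<in> space (\<mu> \<Otimes>\<^sub>M digit_law). T z \<in> G} \<in> sets (\<mu> \<Otimes>\<^sub>M digit_law)" using G by measurable
    qed (use in_G in auto)
    then have "AE z in \<nu>. z \<in> G" unfolding \<nu>_def using G by (subst AE_distr_iff) auto
    then show ?thesis using G by (subst Q.emeasure_eq_1_AE) (auto simp: \<nu>_def)
  qed
  ultimately have "hausdorff_dim_measure \<nu> \<le> 3/4"
    using G by (intro hausdorff_dim_measure_le) auto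
  then show ?thesis
    using Om dims unfolding Omega0_gt_def \<nu>_def T_def by auto
qed

theorem theorem3p11:
  shows "dense_dL (Omega0 :: ('a::euclidean_space) measure set)
       \<and> dense_dL (Omega0_gt :: 'a measure set)"
proof (intro conjI)
  show "dense_dL (Omega0 :: 'a measure set)"
    unfolding dense_dL_def
  proof (intro ballI allI impI)
    fix \<mu> :: "'a measure" and \<epsilon> :: real assume \<mu>: "\<mu> \<in> Omega" and \<epsilon>: "\<epsilon> > 0"
    interpret prob_space \<mu> using \<mu> by (simp add: Omega_def)
    have sets[measurable_cong]: "sets \<mu> = sets borel" using \<mu> by (simp add: Omega_def)
    obtain f :: "'a \<Rightarrow> 'a" where f[measurable]: "f \<in> borel_measurable borel" and fin: "finite (range f)"
      and le: "(\<integral>x. norm (x - f x) \<partial>\<mu>) < \<epsilon>"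
      by (rule simple_function_approx_id[OF \<mu> \<epsilon>])
    obtain K where K: "\<And>x. norm (f x) \<le> K"
      using finite_imp_bounded[OF fin] unfolding bounded_iff by auto
    \<comment> \<open>Writing \<mu> as its own image under the identity couples it with its
      discretisation.\<close>
    have "dL (distr \<mu> borel (\<lambda>x. x)) (distr \<mu> borel f) \<le> (\<integral>x. norm (x - f x) \<partial>\<mu>)"
    proof (rule dL_distr_le[OF prob_space_axioms])
      show "integrable \<mu> (\<lambda>x. norm x)" using \<mu> by (simp add: Omega_def)
      show "integrable \<mu> (\<lambda>x. norm (f x))" by (rule Omega_distrI(2)[OF prob_space_axioms]) (use K in auto)
    qed measurable
    moreover have "distr \<mu> borel (\<lambda>x. x) = \<mu>" by (rule distr_id2) (simp add: sets)
    ultimately have "dL \<mu> (distr \<mu> borel f) < \<epsilon>" using le by simp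
    then show "\<exists>\<nu>\<in>Omega0. dL \<mu> \<nu> < \<epsilon>"
      using distr_finite_range_Omega0[OF \<mu> f fin] by blast
  qed
  show "dense_dL (Omega0_gt :: 'a measure set)"
    unfolding dense_dL_def
  proof (intro ballI allI impI)
    fix \<mu> :: "'a measure" and \<epsilon> :: real assume \<mu>: "\<mu> \<in> Omega" and \<epsilon>: "\<epsilon> > 0"
    interpret prob_space \<mu> using \<mu> by (simp add: Omega_def)
    have sets[measurable_cong]: "sets \<mu> = sets borel" using \<mu> by (simp add: Omega_def)
    have nint: "integrable \<mu> (\<lambda>x. norm x)" using \<mu> by (simp add: Omega_def)
    interpret P: pair_prob_space \<mu> digit_law ..
    have \<epsilon>2: "\<epsilon> / 2 > 0" using \<epsilon> by simp
    obtain f :: "'a \<Rightarrow> 'a" where f[measurable]: "f \<in> borel_measurable borel" and fin: "finite (range f)"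
      and le: "(\<integral>x. norm (x - f x) \<partial>\<mu>) < \<epsilon> / 2"
      by (rule simple_function_approx_id[OF \<mu> \<epsilon>2])
    obtain e :: 'a where "e \<in> Basis" using nonempty_Basis by blast
    then have e: "norm e = 1" by simp
    \<comment> \<open>Blurring moves points by at most c \<le> \<epsilon>/2; discretising uses the
      other half. The cap at 1 is the hypothesis under which the blurred law is analysed.\<close>
    define c where "c = min 1 (\<epsilon> / 2)"
    have c: "0 < c" "c \<le> 1" "c \<le> \<epsilon> / 2" using \<epsilon> by (auto simp: c_def)
    define T where "T = (\<lambda>(x, y). f x + (c * max 0 (min 1 y)) *\<^sub>R e)"
    have [measurable]: "T \<in> borel_measurable (\<mu> \<Otimes>\<^sub>M digit_law)" unfolding T_def by measurable
    obtain K where K: "\<And>x. norm (f x) \<le> K"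
      using finite_imp_bounded[OF fin] unfolding bounded_iff by auto
    have ce: "norm ((c * max 0 (min 1 y)) *\<^sub>R e) \<le> c" for y
      using e c mult_left_mono[of "max 0 (min 1 y)" 1 c] by (simp add: abs_mult)
    have TK: "norm (T z) \<le> K + c" for z
    proof -
      obtain x y where z: "z = (x, y)" by force
      have "norm (T z) \<le> norm (f x) + norm ((c * max 0 (min 1 y)) *\<^sub>R e)"
        unfolding z T_def prod.case by (rule norm_triangle_ineq)
      then show ?thesis using K[of x] ce[of y] by linarith
    qed
    \<comment> \<open>Since \<mu> is the first marginal of the product, \<open>fst\<close> and T
      couple it with the blurred measure.\<close>
    have fst: "distr (\<mu> \<Otimes>\<^sub>M digit_law) borel fst = \<mu>"
      using digit_law.distr_pair_fst[of \<mu>] distr_cong[OF refl sets, of "\<mu> \<Otimes>\<^sub>M digit_law" fst fst] by simp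
    have int_fst: "integrable (\<mu> \<Otimes>\<^sub>M digit_law) (\<lambda>z. g (fst z))"
       "(\<integral>z. g (fst z) \<partial>(\<mu> \<Otimes>\<^sub>M digit_law)) = (\<integral>x. g x \<partial>\<mu>)"
      if g: "integrable \<mu> g" for g :: "'a \<Rightarrow> real"
    proof -
      have gm[measurable]: "g \<in> borel_measurable borel" using g measurable_cong_sets[OF sets refl] borel_measurable_integrable by blast
      have "integrable (distr (\<mu> \<Otimes>\<^sub>M digit_law) borel fst) g" using g by (simp add: fst)
      then show "integrable (\<mu> \<Otimes>\<^sub>M digit_law) (\<lambda>z. g (fst z))" by (subst (asm) integrable_distr_eq) auto
      have "integral\<^sup>L (distr (\<mu> \<Otimes>\<^sub>M digit_law) borel fst) g = (\<integral>z. g (fst z) \<partial>(\<mu> \<Otimes>\<^sub>M digit_law))"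
        by (rule integral_distr) auto
      then show "(\<integral>z. g (fst z) \<partial>(\<mu> \<Otimes>\<^sub>M digit_law)) = (\<integral>x. g x \<partial>\<mu>)" by (simp add: fst)
    qed
    have intT: "integrable (\<mu> \<Otimes>\<^sub>M digit_law) (\<lambda>z. norm (T z))"
      by (rule Omega_distrI(2)[OF P.prob_space_axioms]) (use TK in auto)
    have intf: "integrable \<mu> (\<lambda>x. norm (x - f x))"
    proof (rule Bochner_Integration.integrable_bound[of \<mu> "\<lambda>x. norm x + K"])
      show "AE x in \<mu>. norm (norm (x - f x)) \<le> norm (norm x + K)"
      proof (rule AE_I2)
        fix x show "norm (norm (x - f x)) \<le> norm (norm x + K)"
          using norm_triangle_ineq4[of x "f x"] K[of x] by simp
      qed
    qed (use nint in auto)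
    have "dL (distr (\<mu> \<Otimes>\<^sub>M digit_law) borel fst) (distr (\<mu> \<Otimes>\<^sub>M digit_law) borel T) \<le> (\<integral>z. norm (fst z - T z) \<partial>(\<mu> \<Otimes>\<^sub>M digit_law))"
      by (rule dL_distr_le[OF P.prob_space_axioms]) (use int_fst(1)[OF nint] intT in auto)
    also have "\<dots> \<le> (\<integral>z. norm (fst z - f (fst z)) + c \<partial>(\<mu> \<Otimes>\<^sub>M digit_law))"
    proof (rule integral_mono')
      show "integrable (\<mu> \<Otimes>\<^sub>M digit_law) (\<lambda>z. norm (fst z - f (fst z)) + c)"
        using int_fst(1)[OF intf] by simp
      fix z assume "z \<in> space (\<mu> \<Otimes>\<^sub>M digit_law)"
      obtain x y where z: "z = (x, y)" by force
      have "norm (fst z - T z) = norm ((x - f x) - (c * max 0 (min 1 y)) *\<^sub>R e)" unfolding z T_def by (simp add: algebra_simps)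
      also have "\<dots> \<le> norm (x - f x) + norm ((c * max 0 (min 1 y)) *\<^sub>R e)" by (rule norm_triangle_ineq4)
      finally show "norm (fst z - T z) \<le> norm (fst z - f (fst z)) + c" using ce[of y] by (simp add: z)
    qed (use c in auto)
    also have "\<dots> = (\<integral>x. norm (x - f x) \<partial>\<mu>) + c"
      using int_fst[OF intf] P.prob_space by simp
    also have "\<dots> < \<epsilon>" using le c by simp
    finally have "dL \<mu> (distr (\<mu> \<Otimes>\<^sub>M digit_law) borel T) < \<epsilon>" by (simp add: fst)
    moreover have "distr (\<mu> \<Otimes>\<^sub>M digit_law) borel T \<in> Omega0_gt"
      unfolding T_def by (rule distr_digit_law_Omega0_gt[OF \<mu> f fin e c(1,2)])
    ultimately show "\<exists>\<nu>\<in>Omega0_gt. dL \<mu> \<nu> < \<epsilon>" by blast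
  qed
qed

end
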